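(* Let $n\ge 2$ be an integer, $\rho>0$ and $k\in\mathbb N$. Let $f:\mathbb R\to\mathbb R$ be a continuous odd function such that: $f(0)=0$ and $sf(s)>0$ for $s>0$; $f$ is continuously differentiable in $(0,\infty)$ and $f'\in L^1(0,1)$; $f(s)\ge sf'(s)$ for all $s>0$, and for every $\varepsilon>0$ there exists $s\in(0,\varepsilon)$ such that $f(s)>sf'(s)$. Then the problem $$u''(r)+\frac{n-1}{r}u'(r)+f(u(r))=0\quad (r\in(0,\rho)),\qquad u'(0)=0,\qquad u(\rho)=0$$ has at most one solution satisfying $u(0)>0$ which has exactly $k$ zeros in $(0,\rho)$.
   Context: Solutions are $C^2$ functions $u$ on $[0,\rho]$; $'$ on $u$ denotes $d/dr$. *)

theory Defs
  imports "HOL-Analysis.Analysis"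
begin

(* Derivative relative to S.  On a nondegenerate closed interval it is the one-sided
   derivative at each endpoint, so values of u outside S play no role. *)
definition deriv_within :: "real set \<Rightarrow> (real \<Rightarrow> real) \<Rightarrow> real \<Rightarrow> real" where
  "deriv_within S u r = vector_derivative u (at r within S)"

definition C2_on :: "real set \<Rightarrow> (real \<Rightarrow> real) \<Rightarrow> bool" where
  "C2_on S u \<longleftrightarrow>
     u differentiable_on S \<and>
     deriv_within S u differentiable_on S \<and>
     continuous_on S (deriv_within S (deriv_within S u))"

definition radial_solution ::
  "nat \<Rightarrow> real \<Rightarrow> (real \<Rightarrow> real) \<Rightarrow> (real \<Rightarrow> real) \<Rightarrow> bool" where
  "radial_solution n \<rho> f u \<longleftrightarrow>
     C2_on {0..\<rho>} u \<and>
     (\<forall>r\<in>{0<..<\<rho>}.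
        deriv_within {0..\<rho>} (deriv_within {0..\<rho>} u) r
        + (real n - 1) / r * deriv_within {0..\<rho>} u r + f (u r) = 0) \<and>
     deriv_within {0..\<rho>} u 0 = 0 \<and>
     u \<rho> = 0"

(* Finiteness is required explicitly because card of an infinite set is 0. *)
definition has_exactly_zeros :: "nat \<Rightarrow> real set \<Rightarrow> (real \<Rightarrow> real) \<Rightarrow> bool" where
  "has_exactly_zeros k S u \<longleftrightarrow> finite {r \<in> S. u r = 0} \<and> card {r \<in> S. u r = 0} = k"

end

theory Submission
  imports Defs
begin

text \<open>
  Let \<open>u\<close> and \<open>v\<close> be two solutions with \<open>u 0 > v 0 > 0\<close>. Each zero of \<open>u\<close> then lies strictly to the
  right of the corresponding zero of \<open>v\<close>, and \<open>u\<close> crosses the axis there with the larger slope; as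
  the last zero of both is \<open>\<rho>\<close>, the numbers of interior zeros differ. The induction from one
  zero to the next combines two comparisons. Where \<open>u \<ge> v > 0\<close>, the Wronskian
  \<open>r\<^bsup>n-1\<^esup> (u' v - u v')\<close> is nondecreasing because \<open>f s / s\<close> is nonincreasing, so \<open>u\<close> stays above \<open>v\<close>
  up to the next zero of \<open>v\<close>. On monotone branches, the slopes of \<open>u\<close> and \<open>v\<close> are compared at equal
  heights; there the forcing terms agree and the solution which arrives later has less damping
  \<open>(n-1)/r\<close>, hence keeps the larger slope.

  If \<open>u 0 = v 0\<close>, the initial value problem decides. As \<open>f\<close> need not be Lipschitz at \<open>0\<close>, its
  uniqueness at a zero of \<open>u\<close> is obtained by using the height, rather than the radius, as the
  independent variable: zeros are simple and the system for radius and slope is Lipschitz.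
\<close>

section \<open>Real functions on an interval\<close>

lemma first_zero:
  fixes g :: "real \<Rightarrow> real"
  assumes cont: "continuous_on {a..b} g" and "g a > 0" and "t \<in> {a..b}" "g t \<le> 0"
  obtains s where "a < s" "s \<le> t" "g s = 0" "\<And>r. a \<le> r \<Longrightarrow> r < s \<Longrightarrow> g r > 0"
proof -
  define S where "S = {a..t} \<inter> g -` {0}"
  have ct: "continuous_on {a..t} g"
    using cont by (rule continuous_on_subset) (use assms in auto)
  have "\<exists>x\<ge>a. x \<le> t \<and> g x = 0"
    by (rule IVT2') (use assms ct in auto)
  then have "S \<noteq> {}" by (auto simp: S_def)
  have "closed S"
    unfolding S_def by (rule continuous_closed_preimage[OF ct]) auto
  have bb: "bdd_below S" by (auto simp: S_def)
  then have IS: "Inf S \<in> S" using \<open>S \<noteq> {}\<close> \<open>closed S\<close> by (intro closed_contains_Inf)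
  have pos: "g r > 0" if r: "a \<le> r" "r < Inf S" for r
  proof (rule ccontr)
    assume "\<not> g r > 0"
    then have "\<exists>x\<ge>a. x \<le> r \<and> g x = 0"
      by (intro IVT2') (use assms IS r ct in \<open>auto simp: S_def intro: continuous_on_subset[OF ct]\<close>)
    then obtain x where x: "x \<ge> a" "x \<le> r" "g x = 0" by blast
    then have "x \<in> S" using IS r by (auto simp: S_def)
    then have "Inf S \<le> x" using bb by (rule cInf_lower)
    then show False using x r by linarith
  qed
  have "Inf S \<noteq> a" using IS assms by (auto simp: S_def)
  then show thesis using that[of "Inf S"] IS pos by (auto simp: S_def)
qed

text \<open>A continuation argument: up to a first zero, \<open>g\<close> would be nondecreasing and
  hence at least \<open>g a > 0\<close>, so that zero cannot exist. It resolves the circular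
  estimates below, where the sign of a derivative is known only as long as the quantity itself has
  stayed positive.\<close>

lemma ge_initial_if_nondecreasing_while_positive:
  fixes g g' :: "real \<Rightarrow> real"
  assumes cont: "continuous_on {a..b} g" and pos: "g a > 0"
    and der: "\<And>t. a < t \<Longrightarrow> t < b \<Longrightarrow> (g has_real_derivative g' t) (at t)"
    and nonneg: "\<And>t. a < t \<Longrightarrow> t < b \<Longrightarrow> (\<And>r. a \<le> r \<Longrightarrow> r \<le> t \<Longrightarrow> g r > 0) \<Longrightarrow> g' t \<ge> 0"
    and t: "t \<in> {a..b}"
  shows "g t \<ge> g a"
proof -
  have mono: "g s \<ge> g a" if s: "a \<le> s" "s \<le> b" and p: "\<And>r. a \<le> r \<Longrightarrow> r < s \<Longrightarrow> g r > 0" for s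
  proof (rule DERIV_nonneg_imp_increasing_open[where f = g])
    fix x assume "a < x" "x < s"
    then show "\<exists>y. (g has_real_derivative y) (at x) \<and> y \<ge> 0"
      using der[of x] nonneg[of x] p s by auto
  qed (use s cont in \<open>auto intro: continuous_on_subset\<close>)
  have allpos: "g s > 0" if s: "a \<le> s" "s \<le> b" for s
  proof (rule ccontr)
    assume "\<not> g s > 0"
    then obtain x where x: "a < x" "x \<le> s" "g x = 0" "\<And>r. a \<le> r \<Longrightarrow> r < x \<Longrightarrow> g r > 0"
      using first_zero[OF cont pos, of s] s by auto
    then show False using mono[of x] pos s by auto
  qed
  show ?thesis using mono[of t] allpos t by auto
qed

text \<open>\<open>g t * exp (- K * t)\<close> is nonincreasing and starts at 0. This is the form of
  Gronwall's inequality that both local uniqueness proofs use, with a squared distance as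
  \<open>g\<close>.\<close>

lemma gronwall_zero:
  fixes g g' :: "real \<Rightarrow> real"
  assumes cont: "continuous_on {a..b} g" and "g a = 0"
    and nonneg: "\<And>t. a \<le> t \<Longrightarrow> t \<le> b \<Longrightarrow> g t \<ge> 0"
    and der: "\<And>t. a < t \<Longrightarrow> t < b \<Longrightarrow> (g has_real_derivative g' t) (at t)"
    and le: "\<And>t. a < t \<Longrightarrow> t < b \<Longrightarrow> g' t \<le> K * g t"
    and t: "t \<in> {a..b}"
  shows "g t = 0"
proof -
  define h where "h t = - (g t * exp (- K * t))" for t
  have "h a \<le> h t"
  proof (rule DERIV_nonneg_imp_increasing_open[where f = h])
    fix x assume x: "a < x" "x < t"
    then have "(h has_real_derivative (- (g' x * exp (- K * x) + g x * (exp (- K * x) * (- K))))) (at x)"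
      unfolding h_def using t by (auto intro!: derivative_eq_intros der)
    moreover have "- (g' x * exp (- K * x) + g x * (exp (- K * x) * (- K))) = (K * g x - g' x) * exp (- K * x)"
      by (simp add: algebra_simps)
    moreover have "\<dots> \<ge> 0" using le[of x] x t by simp
    ultimately show "\<exists>y. (h has_real_derivative y) (at x) \<and> 0 \<le> y" by metis
  qed (use t cont in \<open>auto simp: h_def intro!: continuous_intros intro: continuous_on_subset\<close>)
  then have "g t \<le> 0" using assms by (simp add: h_def mult_le_0_iff)
  then show ?thesis using nonneg[of t] t by auto
qed

text \<open>This makes the height available as the independent variable. Positivity of
  \<open>dw\<close> is asked for only in the open interval, so that a branch of a hump can be
  inverted up to its top, where the slope vanishes.\<close>

lemma inverse_of_increasing:
  fixes w dw :: "real \<Rightarrow> real"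
  assumes "a < b" and cont: "continuous_on {a..b} w"
    and der: "\<And>t. a < t \<Longrightarrow> t < b \<Longrightarrow> (w has_real_derivative dw t) (at t)"
    and pos: "\<And>t. a < t \<Longrightarrow> t < b \<Longrightarrow> dw t > 0"
  obtains R where "continuous_on {w a..w b} R"
    "\<And>t. t \<in> {a..b} \<Longrightarrow> R (w t) = t"
    "\<And>s. s \<in> {w a..w b} \<Longrightarrow> R s \<in> {a..b} \<and> w (R s) = s"
    "\<And>s. w a < s \<Longrightarrow> s < w b \<Longrightarrow>
       a < R s \<and> R s < b \<and> (R has_real_derivative 1 / dw (R s)) (at s)"
proof -
  have mono: "w x < w y" if "a \<le> x" "x < y" "y \<le> b" for x y
  proof (rule DERIV_pos_imp_increasing_open[where f = w, OF \<open>x < y\<close>])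
    fix t assume "x < t" "t < y"
    then show "\<exists>d. (w has_real_derivative d) (at t) \<and> d > 0"
      using that by (intro exI[of _ "dw t"] conjI der pos) auto
  qed (use that in \<open>auto intro: continuous_on_subset[OF cont]\<close>)
  then have inj: "inj_on w {a..b}"
    by (intro linorder_inj_onI) (auto, metis less_irrefl)
  define R where "R = the_inv_into {a..b} w"
  have left: "R (w t) = t" if "t \<in> {a..b}" for t
    unfolding R_def using inj that by (rule the_inv_into_f_f)
  have img: "w ` {a..b} = {w a..w b}"
  proof
    show "w ` {a..b} \<subseteq> {w a..w b}"
      using mono by (force simp: le_less)
    show "{w a..w b} \<subseteq> w ` {a..b}"
      using IVT'[of w a _ b] cont \<open>a < b\<close> by (force simp: image_def)
  qed
  have right: "R s \<in> {a..b} \<and> w (R s) = s" if "s \<in> {w a..w b}" for s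
    using that img left by (metis imageE)
  have cR: "continuous_on {w a..w b} R"
    using continuous_on_inv[OF cont, of R] left img by auto
  have "a < R s \<and> R s < b \<and> (R has_real_derivative 1 / dw (R s)) (at s)" if s: "w a < s" "s < w b" for s
  proof -
    have r: "a < R s" "R s < b"
      using right[of s] s by (auto simp: less_le)
    have "isCont R s"
      using cR s by (simp add: continuous_on_interior)
    then have "DERIV R s :> inverse (dw (R s))"
      using DERIV_inverse_function[where f = w and g = R and a = "w a" and b = "w b"] der[OF r] pos[OF r] s right by auto
    then show ?thesis using r by (simp add: inverse_eq_divide)
  qed
  then show thesis using that cR left right by blast
qed

lemma isCont_neg_neighbourhood:
  fixes g :: "real \<Rightarrow> real"
  assumes "isCont g x" "g x < 0"
  obtains d where "d > 0" "\<And>t. \<bar>t - x\<bar> < d \<Longrightarrow> g t < 0"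
proof -
  have "eventually (\<lambda>t. g t < 0) (nhds x)"
    using assms by (intro order_tendstoD(2)) (auto simp: isCont_def tendsto_at_iff_tendsto_nhds)
  then show thesis
    using that by (auto simp: eventually_nhds_metric dist_real_def)
qed

lemma constant_sign_if_no_zeros:
  fixes g :: "real \<Rightarrow> real"
  assumes "continuous_on {a<..<b} g" and nz: "\<And>t. a < t \<Longrightarrow> t < b \<Longrightarrow> g t \<noteq> 0"
    and s: "a < s" "s < b" "g s > 0" and t: "a < t" "t < b"
  shows "g t > 0"
proof (rule ccontr)
  assume "\<not> g t > 0"
  have "connected (g ` {a<..<b})" using assms(1) by (intro connected_continuous_image) auto
  then have "0 \<in> g ` {a<..<b}"
    using s t \<open>\<not> g t > 0\<close> by (intro connectedD_interval[of _ "g t" "g s" 0]) auto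
  then show False using nz by auto
qed

lemma eq_at_right_endpoint:
  fixes g :: "real \<Rightarrow> real"
  assumes "a < b" "continuous_on {a..b} g" "\<And>t. a < t \<Longrightarrow> t < b \<Longrightarrow> g t = c"
  shows "g b = c"
  using continuous_constant_on_closure[of "{a<..<b}" g c b] assms by auto

lemma right_neighbourhood:
  fixes g :: "real \<Rightarrow> real"
  assumes cont: "continuous_on {a..b} g" and "a < b" "open U" "g a \<in> U"
  obtains c where "a < c" "c \<le> b" "\<And>t. a \<le> t \<Longrightarrow> t \<le> c \<Longrightarrow> g t \<in> U"
proof -
  obtain e where e: "e > 0" "\<And>x. dist x (g a) < e \<Longrightarrow> x \<in> U"
    using assms by (metis openE mem_ball dist_commute subsetD)
  obtain d where d: "d > 0" "\<And>x. x \<in> {a..b} \<Longrightarrow> dist x a < d \<Longrightarrow> dist (g x) (g a) < e"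
    using cont e(1) \<open>a < b\<close> unfolding continuous_on_iff
    by (metis atLeastAtMost_iff less_imp_le order.refl)
  obtain c where "a < c" "c < min b (a + d)"
    using dense[of a "min b (a + d)"] d \<open>a < b\<close> by auto
  then show thesis
    using d(2) e(2) by (intro that[of c]) (auto simp: dist_real_def)
qed

section \<open>Solutions and their humps\<close>

locale sublinear_radial =
  fixes n :: nat and \<rho> :: real and f :: "real \<Rightarrow> real"
  assumes n_ge_2: "n \<ge> 2"
    and rho_pos: "\<rho> > 0"
    and f_cont: "continuous_on UNIV f"
    and f_odd: "f (- s) = - f s"
    and f_pos: "s > 0 \<Longrightarrow> f s > 0"
    and f_diff: "f differentiable_on {0<..}"
    and f_deriv_cont: "continuous_on {0<..} (deriv f)"
    and f_sublinear: "s > 0 \<Longrightarrow> f s \<ge> s * deriv f s"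
    and f_strict: "\<epsilon> > 0 \<Longrightarrow> \<exists>s\<in>{0<..<\<epsilon>}. f s > s * deriv f s"
begin

section \<open>The nonlinearity: monotonicity of \<open>f s / s\<close> and Lipschitz bounds away
  from 0\<close>

lemma f_has_deriv: "s > 0 \<Longrightarrow> (f has_real_derivative deriv f s) (at s)"
  using f_diff
  by (metis DERIV_deriv_iff_real_differentiable differentiable_on_eq_differentiable_at
      greaterThan_iff open_greaterThan)

lemma quotient_has_deriv:
  "s > 0 \<Longrightarrow> ((\<lambda>s. f s / s) has_real_derivative (s * deriv f s - f s) / s\<^sup>2) (at s)"
  by (auto intro!: derivative_eq_intros f_has_deriv simp: power2_eq_square field_simps)

text \<open>The derivative of \<open>f s / s\<close> is nonpositive by \<open>f_sublinear\<close>.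
  Denominators are cleared because the derivative of the Wronskian contains exactly this difference,
  with the heights of \<open>v\<close> and \<open>u\<close> as \<open>s\<close> and
  \<open>t\<close>.\<close>

lemma f_antimono_quotient:
  assumes "0 < s" "s \<le> t"
  shows "f t * s \<le> f s * t"
proof -
  have "f t / t \<le> f s / s"
  proof (rule DERIV_nonpos_imp_nonincreasing[where f = "\<lambda>s. f s / s"])
    fix x assume "s \<le> x" "x \<le> t"
    then have "x > 0" using assms by simp
    then show "\<exists>y. ((\<lambda>s. f s / s) has_real_derivative y) (at x) \<and> y \<le> 0"
      using quotient_has_deriv f_sublinear by (intro exI conjI) (auto simp: divide_nonpos_nonneg)
  qed (use assms in auto)
  then show ?thesis using assms by (simp add: field_simps)
qed

text \<open>Equality at \<open>x\<close> and \<open>y\<close> would make the monotone quotient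
  constant between them, so its derivative would vanish at \<open>s\<close>, where
  \<open>f_strict\<close> makes it negative. One such height below \<open>v 0\<close> is enough to
  separate the first zeros of two solutions.\<close>

lemma f_antimono_quotient_strict_near_0:
  assumes "\<epsilon> > 0"
  obtains s where "0 < s" "s < \<epsilon>" "\<And>x y. 0 < x \<Longrightarrow> x < s \<Longrightarrow> s < y \<Longrightarrow> f y * x < f x * y"
proof -
  obtain s where s: "0 < s" "s < \<epsilon>" "f s > s * deriv f s"
    using f_strict[OF assms] by auto
  have "f y * x < f x * y" if xy: "0 < x" "x < s" "s < y" for x y
  proof (rule ccontr)
    assume "\<not> ?thesis"
    then have eq: "f y / y = f x / x"
      using f_antimono_quotient[of x y] xy by (simp add: field_simps)
    have const: "f z / z = f x / x" if "x \<le> z" "z \<le> y" for z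
    proof (rule antisym)
      show "f z / z \<le> f x / x"
        using f_antimono_quotient[of x z] that xy by (simp add: field_simps)
      show "f x / x \<le> f z / z"
        unfolding eq[symmetric] using f_antimono_quotient[of z y] that xy by (simp add: field_simps)
    qed
    have "(s * deriv f s - f s) / s\<^sup>2 = 0"
    proof (rule DERIV_local_const[OF quotient_has_deriv[OF s(1)]])
      show "min (s - x) (y - s) > 0" using xy by simp
      show "\<forall>z. \<bar>s - z\<bar> < min (s - x) (y - s) \<longrightarrow> f s / s = f z / z"
      proof (intro allI impI)
        fix z assume "\<bar>s - z\<bar> < min (s - x) (y - s)"
        then have "x \<le> z" "z \<le> y" by linarith+
        then show "f s / s = f z / z"
          using const[of z] const[of s] xy by simp
      qed
    qed
    then show False using s by simp
  qed
  then show thesis using that s by blast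
qed

lemma f_lipschitz:
  assumes "0 < a"
  obtains L where "L \<ge> 0" "\<And>x y. x \<in> {a..b} \<Longrightarrow> y \<in> {a..b} \<Longrightarrow> \<bar>f x - f y\<bar> \<le> L * \<bar>x - y\<bar>"
proof -
  have "compact (deriv f ` {a..b})"
    using assms by (intro compact_continuous_image continuous_on_subset[OF f_deriv_cont]) auto
  then have "bounded (deriv f ` {a..b})" by (rule compact_imp_bounded)
  then obtain B where B: "\<And>x. x \<in> {a..b} \<Longrightarrow> \<bar>deriv f x\<bar> \<le> B"
    unfolding bounded_iff by (metis image_eqI real_norm_def)
  \<comment> \<open>\<open>B\<close> may be negative when \<open>{a..b}\<close> is empty; its
    absolute value is a Lipschitz constant with the required sign in every case.\<close>
  have "\<bar>f x - f y\<bar> \<le> \<bar>B\<bar> * \<bar>x - y\<bar>" if "x \<in> {a..b}" "y \<in> {a..b}" for x y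
  proof -
    have "norm (f x - f y) \<le> \<bar>B\<bar> * norm (x - y)"
    proof (rule field_differentiable_bound[of "{a..b}" f "deriv f"])
      fix z assume z: "z \<in> {a..b}"
      then show "(f has_real_derivative deriv f z) (at z within {a..b})"
        using assms has_field_derivative_at_within[OF f_has_deriv[of z]] by simp
      show "norm (deriv f z) \<le> \<bar>B\<bar>"
        using B[OF z] by auto
    qed (use that in auto)
    then show ?thesis by simp
  qed
  then show thesis using that[of "\<bar>B\<bar>"] by auto
qed

text \<open>The equation as a first order system for the pair \<open>u\<close>, \<open>du\<close>.
  Two-sided derivatives are used inside the interval and mere continuity at its ends; the conditions
  at the centre and at \<open>\<rho>\<close> are kept apart, since most comparisons concern a single
  hump.\<close>

definition sol :: "(real \<Rightarrow> real) \<Rightarrow> (real \<Rightarrow> real) \<Rightarrow> bool" where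
  "sol u du \<longleftrightarrow> continuous_on {0..\<rho>} u \<and> continuous_on {0..\<rho>} du \<and>
     (\<forall>t. 0 < t \<longrightarrow> t < \<rho> \<longrightarrow> (u has_real_derivative du t) (at t) \<and>
        (du has_real_derivative (- ((real n - 1) / t * du t) - f (u t))) (at t))"

lemma sol_cont:
  assumes "sol u du" "0 \<le> a" "b \<le> \<rho>"
  shows "continuous_on {a..b} u" "continuous_on {a..b} du"
  using assms by (auto simp: sol_def intro: continuous_on_subset)

lemma sol_deriv:
  assumes "sol u du" "0 < t" "t < \<rho>"
  shows "(u has_real_derivative du t) (at t)"
    "(du has_real_derivative (- ((real n - 1) / t * du t) - f (u t))) (at t)"
  using assms by (auto simp: sol_def)

text \<open>By oddness of \<open>f\<close>. Negative humps thereby become positive ones, and all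
  comparisons can be stated for positive humps.\<close>

lemma sol_uminus:
  assumes "sol u du"
  shows "sol (\<lambda>t. - u t) (\<lambda>t. - du t)"
  unfolding sol_def
proof (intro conjI allI impI)
  fix t assume t: "0 < t" "t < \<rho>"
  show "((\<lambda>t. - u t) has_real_derivative - du t) (at t)"
    by (intro derivative_intros sol_deriv assms t)
  have "((\<lambda>t. - du t) has_real_derivative - (- ((real n - 1) / t * du t) - f (u t))) (at t)"
    by (intro derivative_intros sol_deriv assms t)
  then show "((\<lambda>t. - du t) has_real_derivative - ((real n - 1) / t * - du t) - f (- u t)) (at t)"
    by (simp add: f_odd add.commute)
qed (use assms in \<open>simp_all add: sol_def continuous_on_minus\<close>)

text \<open>The divergence form of the equation: \<open>t ^ (n - 1)\<close> is the integrating
  factor that absorbs the damping term.\<close>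

lemma flux_has_deriv:
  assumes "sol u du" "0 < t" "t < \<rho>"
  shows "((\<lambda>t. t ^ (n - 1) * du t) has_real_derivative - (t ^ (n - 1) * f (u t))) (at t)"
proof -
  \<comment> \<open>Splitting off one factor cancels the \<open>1 / t\<close> of the damping term;
    with exponents in the natural numbers this relies on \<open>n - 1 > 0\<close>.\<close>
  have pw: "t ^ (n - 1) = t * t ^ (n - 1 - 1)"
    using n_ge_2 by (simp add: power_eq_if)
  have "((\<lambda>t. t ^ (n - 1) * du t) has_real_derivative
     real (n - 1) * t ^ (n - 1 - 1) * du t + t ^ (n - 1) * (- ((real n - 1) / t * du t) - f (u t))) (at t)"
    using sol_deriv[OF assms] by (auto intro!: derivative_eq_intros)
  moreover have "t ^ (n - 1) * ((real n - 1) / t * du t) = real (n - 1) * t ^ (n - 1 - 1) * du t"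
    using n_ge_2 assms by (subst pw) (simp add: of_nat_diff)
  ultimately show ?thesis by (simp add: right_diff_distrib)
qed

text \<open>Where \<open>u\<close> is positive, so is \<open>f (u t)\<close>, and the flux has
  negative derivative. Since the flux has the sign of \<open>du\<close> for positive radii, a single
  zero of \<open>du\<close> decides its sign on both sides; this is what gives a hump only one
  top.\<close>

lemma flux_strict_antimono:
  assumes u: "sol u du" and "0 \<le> a" "b \<le> \<rho>" and pos: "\<And>t. a < t \<Longrightarrow> t < b \<Longrightarrow> u t > 0"
    and xy: "a \<le> x" "x < y" "y \<le> b"
  shows "y ^ (n - 1) * du y < x ^ (n - 1) * du x"
proof (rule DERIV_neg_imp_decreasing_open[where f = "\<lambda>t. t ^ (n - 1) * du t", OF \<open>x < y\<close>])
  fix t assume t: "x < t" "t < y"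
  then have "0 < t" "t < \<rho>" "f (u t) > 0"
    using \<open>0 \<le> a\<close> \<open>b \<le> \<rho>\<close> xy f_pos[OF pos[of t]] by auto
  then show "\<exists>d. ((\<lambda>t. t ^ (n - 1) * du t) has_real_derivative d) (at t) \<and> d < 0"
    using flux_has_deriv[OF u, of t] by (intro exI conjI) auto
next
  show "continuous_on {x..y} (\<lambda>t. t ^ (n - 1) * du t)"
    using \<open>0 \<le> a\<close> \<open>b \<le> \<rho>\<close> xy by (intro continuous_intros sol_cont(2)[OF u]) auto
qed

text \<open>A hump on \<open>[a, b]\<close> with top \<open>c\<close>; \<open>a = c = 0\<close> is the hump around the centre of the ball.\<close>
definition hump :: "(real \<Rightarrow> real) \<Rightarrow> (real \<Rightarrow> real) \<Rightarrow> real \<Rightarrow> real \<Rightarrow> real \<Rightarrow> bool" where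
  "hump u du a c b \<longleftrightarrow> sol u du \<and> 0 \<le> a \<and> a \<le> c \<and> c < b \<and> b \<le> \<rho> \<and> u b = 0 \<and> du c = 0 \<and>
     (\<forall>t. a < t \<longrightarrow> t < b \<longrightarrow> u t > 0) \<and>
     (\<forall>t. a \<le> t \<longrightarrow> t < c \<longrightarrow> du t > 0) \<and> (\<forall>t. c < t \<longrightarrow> t \<le> b \<longrightarrow> du t < 0)"

text \<open>Rolle's theorem supplies the top, and the decreasing flux the sign of the slope on
  either side of it.\<close>

lemma hump_exists:
  assumes u: "sol u du" and "0 \<le> a" "a < b" "b \<le> \<rho>" "u a = 0" "u b = 0"
    and pos: "\<And>t. a < t \<Longrightarrow> t < b \<Longrightarrow> u t > 0"
  obtains c where "a < c" "hump u du a c b"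
proof -
  have "\<exists>c>a. c < b \<and> (u has_real_derivative 0) (at c)"
  proof (rule Rolle[OF \<open>a < b\<close>])
    fix x assume "a < x" "x < b"
    then show "u differentiable (at x)"
      using sol_deriv(1)[OF u, of x] \<open>0 \<le> a\<close> \<open>b \<le> \<rho>\<close> by (auto simp: real_differentiable_def)
  qed (use assms sol_cont(1)[OF u] in auto)
  then obtain c where c: "a < c" "c < b" and "(u has_real_derivative 0) (at c)" by blast
  then have dc: "du c = 0"
    using DERIV_unique sol_deriv(1)[OF u, of c] assms by auto
  note fl = flux_strict_antimono[OF u \<open>0 \<le> a\<close> \<open>b \<le> \<rho>\<close> pos]
  have "du t > 0" if "a \<le> t" "t < c" for t
    using fl[of t c] that c dc \<open>0 \<le> a\<close> by (auto simp: zero_less_mult_iff)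
  moreover have "du t < 0" if "c < t" "t \<le> b" for t
    using fl[of c t] that c dc \<open>0 \<le> a\<close> by (auto simp: mult_less_0_iff)
  ultimately have "hump u du a c b"
    using assms c dc by (auto simp: hump_def)
  then show thesis using that c by blast
qed

text \<open>The flux is 0 at the centre and decreases from there, so the hump has no ascending
  branch.\<close>

lemma hump_from_centre:
  assumes u: "sol u du" and "0 < b" "b \<le> \<rho>" "du 0 = 0" "u b = 0"
    and pos: "\<And>t. 0 \<le> t \<Longrightarrow> t < b \<Longrightarrow> u t > 0"
  shows "hump u du 0 0 b"
proof -
  have "du t < 0" if "0 < t" "t \<le> b" for t
    using flux_strict_antimono[OF u order.refl \<open>b \<le> \<rho>\<close>, of 0 t] pos that \<open>du 0 = 0\<close>
    by (auto simp: mult_less_0_iff)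
  then show ?thesis using assms by (auto simp: hump_def)
qed

text \<open>Lagrange's identity: when the Wronskian is written with the two fluxes, the products
  \<open>du t * dv t\<close> cancel and only the forcing terms remain.\<close>

lemma wronskian_has_deriv:
  assumes "sol u du" "sol v dv" "0 < t" "t < \<rho>"
  shows "((\<lambda>t. t ^ (n - 1) * (du t * v t - u t * dv t)) has_real_derivative
     t ^ (n - 1) * (u t * f (v t) - f (u t) * v t)) (at t)"
proof -
  have "((\<lambda>t. (t ^ (n - 1) * du t) * v t - u t * (t ^ (n - 1) * dv t)) has_real_derivative
     ((t ^ (n - 1) * du t) * dv t + - (t ^ (n - 1) * f (u t)) * v t)
      - (u t * - (t ^ (n - 1) * f (v t)) + du t * (t ^ (n - 1) * dv t))) (at t)"
    by (rule DERIV_diff[OF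
          DERIV_mult'[OF flux_has_deriv[OF assms(1,3,4)] sol_deriv(1)[OF assms(2,3,4)]]
          DERIV_mult'[OF sol_deriv(1)[OF assms(1,3,4)] flux_has_deriv[OF assms(2,3,4)]]])
  moreover have "(\<lambda>t. (t ^ (n - 1) * du t) * v t - u t * (t ^ (n - 1) * dv t))
      = (\<lambda>t. t ^ (n - 1) * (du t * v t - u t * dv t))"
    by (simp add: algebra_simps fun_eq_iff)
  ultimately show ?thesis
    by (simp add: algebra_simps)
qed

lemma
  assumes h: "hump u du a c b"
  shows hump_increasing: "\<And>x y. a \<le> x \<Longrightarrow> x < y \<Longrightarrow> y \<le> c \<Longrightarrow> u x < u y"
    and hump_decreasing: "\<And>x y. c \<le> x \<Longrightarrow> x < y \<Longrightarrow> y \<le> b \<Longrightarrow> u y < u x"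
    and hump_max: "\<And>x. a \<le> x \<Longrightarrow> x \<le> b \<Longrightarrow> u x \<le> u c"
proof -
  have u: "sol u du" and ab: "0 \<le> a" "a \<le> c" "c < b" "b \<le> \<rho>"
    and incr: "\<And>t. a \<le> t \<Longrightarrow> t < c \<Longrightarrow> du t > 0" and decr: "\<And>t. c < t \<Longrightarrow> t \<le> b \<Longrightarrow> du t < 0"
    using h by (auto simp: hump_def)
  show inc: "u x < u y" if "a \<le> x" "x < y" "y \<le> c" for x y
  proof (rule DERIV_pos_imp_increasing_open[where f = u, OF \<open>x < y\<close>])
    fix t assume t: "x < t" "t < y"
    then show "\<exists>d. (u has_real_derivative d) (at t) \<and> d > 0"
      using that ab by (intro exI[of _ "du t"] conjI sol_deriv(1)[OF u] incr) auto
  qed (use that ab in \<open>auto intro: sol_cont(1)[OF u]\<close>)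
  show dec: "u y < u x" if "c \<le> x" "x < y" "y \<le> b" for x y
  proof (rule DERIV_neg_imp_decreasing_open[where f = u, OF \<open>x < y\<close>])
    fix t assume t: "x < t" "t < y"
    then show "\<exists>d. (u has_real_derivative d) (at t) \<and> d < 0"
      using that ab by (intro exI[of _ "du t"] conjI sol_deriv(1)[OF u] decr) auto
  qed (use that ab in \<open>auto intro: sol_cont(1)[OF u]\<close>)
  show "u x \<le> u c" if "a \<le> x" "x \<le> b" for x
    using inc[of x c] dec[of c x] that by (cases x c rule: linorder_cases) auto
qed

section \<open>Comparison on one hump\<close>

text \<open>The Wronskian is the numerator of the derivative of \<open>u / v\<close>. Its sign
  therefore preserves the order \<open>v t \<le> u t\<close> once this holds at
  \<open>x\<close>.\<close>

lemma ratio_mono: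
  assumes u: "sol u du" and v: "sol v dv" and xy: "0 \<le> x" "x \<le> y" "y \<le> \<rho>"
    and vpos: "\<And>t. x \<le> t \<Longrightarrow> t \<le> y \<Longrightarrow> v t > 0"
    and W: "\<And>t. x < t \<Longrightarrow> t < y \<Longrightarrow> du t * v t - u t * dv t \<ge> 0"
  shows "u x / v x \<le> u y / v y"
proof (rule DERIV_nonneg_imp_increasing_open[where f = "\<lambda>t. u t / v t", OF \<open>x \<le> y\<close>])
  fix t assume t: "x < t" "t < y"
  then have "v t > 0" using vpos by auto
  then have "((\<lambda>t. u t / v t) has_real_derivative (du t * v t - u t * dv t) / (v t * v t)) (at t)"
    using t xy by (intro DERIV_divide sol_deriv(1)[OF u] sol_deriv(1)[OF v]) auto
  then show "\<exists>d. ((\<lambda>t. u t / v t) has_real_derivative d) (at t) \<and> d \<ge> 0"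
    using W[OF t] by (intro exI conjI) auto
next
  show "continuous_on {x..y} (\<lambda>t. u t / v t)"
    using xy by (intro continuous_on_divide sol_cont(1)[OF u] sol_cont(1)[OF v]) (auto simp: less_imp_neq[OF vpos, symmetric])
qed

lemma ratio_strict_mono:
  assumes u: "sol u du" and v: "sol v dv" and xy: "0 \<le> x" "x < y" "y \<le> \<rho>"
    and vpos: "\<And>t. x \<le> t \<Longrightarrow> t \<le> y \<Longrightarrow> v t > 0"
    and W: "\<And>t. x < t \<Longrightarrow> t < y \<Longrightarrow> du t * v t - u t * dv t > 0"
  shows "u x / v x < u y / v y"
proof (rule DERIV_pos_imp_increasing_open[where f = "\<lambda>t. u t / v t", OF \<open>x < y\<close>])
  fix t assume t: "x < t" "t < y"
  then have "v t > 0" using vpos by auto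
  then have "((\<lambda>t. u t / v t) has_real_derivative (du t * v t - u t * dv t) / (v t * v t)) (at t)"
    using t xy by (intro DERIV_divide sol_deriv(1)[OF u] sol_deriv(1)[OF v]) auto
  then show "\<exists>d. ((\<lambda>t. u t / v t) has_real_derivative d) (at t) \<and> d > 0"
    using W[OF t] \<open>v t > 0\<close> by (meson divide_pos_pos mult_pos_pos)
next
  show "continuous_on {x..y} (\<lambda>t. u t / v t)"
    using xy by (intro continuous_on_divide sol_cont(1)[OF u] sol_cont(1)[OF v]) (auto simp: less_imp_neq[OF vpos, symmetric])
qed

lemma wronskian_cont:
  assumes "sol u du" "sol v dv" "0 \<le> a" "b \<le> \<rho>"
  shows "continuous_on {a..b} (\<lambda>t. t ^ (n - 1) * (du t * v t - u t * dv t))"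
  using assms by (intro continuous_intros sol_cont(1)[OF assms(1)] sol_cont(1)[OF assms(2)]
      sol_cont(2)[OF assms(1)] sol_cont(2)[OF assms(2)]) auto

text \<open>While the weighted Wronskian \<open>W\<close> is positive, \<open>u / v\<close> does not
  decrease and stays at least 1; while it is at least 1, \<open>W\<close> does not decrease.
  Continuation from \<open>y\<close> makes \<open>W\<close> positive as long as both humps last. A
  zero \<open>bu\<close> not after \<open>bv\<close> is then impossible, because the unweighted
  Wronskian there is \<open>du bu * v bu\<close>, which is nonpositive.\<close>

lemma later_zero_if_overtaken:
  assumes hu: "hump u du au cu bu" and hv: "hump v dv av cv bv"
    and y: "au < y" "y < bu" "av < y" "y < bv" "v y \<le> u y" "du y * v y - u y * dv y > 0"
  shows "bv < bu" and "\<And>t. y < t \<Longrightarrow> t \<le> bv \<Longrightarrow> v t < u t"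
proof -
  have u: "sol u du" and v: "sol v dv"
    and ab: "0 \<le> au" "au \<le> cu" "cu < bu" "bu \<le> \<rho>" "0 \<le> av" "av \<le> cv" "cv < bv" "bv \<le> \<rho>"
    and upos: "\<And>t. au < t \<Longrightarrow> t < bu \<Longrightarrow> u t > 0" and vpos: "\<And>t. av < t \<Longrightarrow> t < bv \<Longrightarrow> v t > 0"
    and end_points: "u bu = 0" "v bv = 0" "du bu < 0"
    using hu hv by (auto simp: hump_def)
  define b where "b = min bu bv"
  have yb: "y < b" "b \<le> bu" "b \<le> bv" using y by (auto simp: b_def)
  define W where "W t = t ^ (n - 1) * (du t * v t - u t * dv t)" for t
  have W_pos_iff: "W t > 0 \<longleftrightarrow> du t * v t - u t * dv t > 0" if "t \<ge> y" for t
    using that y ab by (auto simp: W_def zero_less_mult_iff)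
  have "W t \<ge> W y" if "t \<in> {y..b}" for t
  proof (rule ge_initial_if_nondecreasing_while_positive[OF _ _ _ _ that])
    show "continuous_on {y..b} W"
      unfolding W_def using yb y ab by (intro wronskian_cont u v) auto
    show "W y > 0" using W_pos_iff y by simp
    fix t assume t: "y < t" "t < b"
    show "(W has_real_derivative t ^ (n - 1) * (u t * f (v t) - f (u t) * v t)) (at t)"
      unfolding W_def using t yb y ab by (intro wronskian_has_deriv u v) auto
    assume pos: "\<And>r. y \<le> r \<Longrightarrow> r \<le> t \<Longrightarrow> W r > 0"
    have "u y / v y \<le> u t / v t"
      using t y yb ab pos W_pos_iff by (intro ratio_mono[OF u v]) (auto intro: vpos less_imp_le)
    moreover have "u y / v y \<ge> 1" using y vpos[of y] by simp
    moreover have vt: "v t > 0" using t y yb by (intro vpos) auto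
    ultimately have "u t / v t \<ge> 1" by linarith
    then have "v t \<le> u t" using vt by simp
    then have "u t * f (v t) - f (u t) * v t \<ge> 0"
      using f_antimono_quotient[of "v t" "u t"] vt by (simp add: mult.commute)
    then show "t ^ (n - 1) * (u t * f (v t) - f (u t) * v t) \<ge> 0"
      using t y ab by simp
  qed
  moreover have "W y > 0" using W_pos_iff y by simp
  ultimately have Wpos: "W t > 0" if "y \<le> t" "t \<le> b" for t
    using that by (meson atLeastAtMost_iff less_le_trans)
  show less: "bv < bu"
  proof (rule ccontr)
    assume "\<not> bv < bu"
    then have b: "b = bu" by (simp add: b_def)
    then have "v bu \<ge> 0" using vpos[of bu] end_points yb y \<open>\<not> bv < bu\<close> by (cases "bu = bv") auto
    then have "du bu * v bu \<le> 0" using end_points by (simp add: mult_nonpos_nonneg)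
    then show False using Wpos[of b] W_pos_iff[of b] yb end_points b by simp
  qed
  fix t assume t: "y < t" "t \<le> bv"
  show "v t < u t"
  proof (cases "t = bv")
    case True
    then show ?thesis using upos[of bv] less end_points y by auto
  next
    case False
    have "u y / v y < u t / v t"
      using t y yb ab less False Wpos W_pos_iff
      by (intro ratio_strict_mono[OF u v]) (auto intro: vpos simp: b_def)
    moreover have "u y / v y \<ge> 1" using y vpos[of y] by simp
    moreover have vt: "v t > 0" using t y yb False by (intro vpos) auto
    ultimately have "u t / v t > 1" by linarith
    then show ?thesis using vt by simp
  qed
qed

text \<open>The Wronskian is only 0 at the centre, so the continuation runs on
  \<open>u / v - 1\<close>, which starts positive. This still permits \<open>bu = bv\<close>. In
  that case \<open>W\<close> would vanish identically, and \<open>f s / s\<close> would take equal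
  values at the heights of \<open>u\<close> and \<open>v\<close> at every radius, against its strict
  decrease across some small height.\<close>

lemma later_zero_from_centre:
  assumes hu: "hump u du 0 0 bu" and hv: "hump v dv 0 0 bv" and less0: "0 < v 0" "v 0 < u 0"
  shows "bv < bu" and "\<And>t. 0 \<le> t \<Longrightarrow> t \<le> bv \<Longrightarrow> v t < u t"
proof -
  have u: "sol u du" and v: "sol v dv"
    and ab: "0 < bu" "bu \<le> \<rho>" "0 < bv" "bv \<le> \<rho>"
    and upos: "\<And>t. 0 \<le> t \<Longrightarrow> t < bu \<Longrightarrow> u t > 0" and vpos: "\<And>t. 0 \<le> t \<Longrightarrow> t < bv \<Longrightarrow> v t > 0"
    and end_points: "u bu = 0" "v bv = 0"
    using hu hv less0 by (auto simp: hump_def le_less)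
  define b where "b = min bu bv"
  have b: "0 < b" "b \<le> bu" "b \<le> bv" using ab by (auto simp: b_def)
  define W where "W t = t ^ (n - 1) * (du t * v t - u t * dv t)" for t
  have W0: "W 0 = 0" using n_ge_2 by (simp add: W_def power_0_left)
  have W_cont: "continuous_on {0..b} W"
    unfolding W_def using b ab by (intro wronskian_cont u v) auto
  have W_deriv: "(W has_real_derivative t ^ (n - 1) * (u t * f (v t) - f (u t) * v t)) (at t)"
    if "0 < t" "t < b" for t
    unfolding W_def using that b ab by (intro wronskian_has_deriv u v) auto
  have W'_nonneg: "t ^ (n - 1) * (u t * f (v t) - f (u t) * v t) \<ge> 0"
    if "0 < t" "t < b" "v t \<le> u t" for t
  proof -
    have "u t * f (v t) - f (u t) * v t \<ge> 0"
      using f_antimono_quotient[of "v t" "u t"] vpos[of t] that b by (simp add: mult.commute)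
    then show ?thesis using that by simp
  qed
  have W_mono: "W x \<le> W y" if "0 \<le> x" "x \<le> y" "y \<le> b" "\<And>r. x < r \<Longrightarrow> r < y \<Longrightarrow> v r \<le> u r" for x y
  proof (rule DERIV_nonneg_imp_increasing_open[where f = W, OF \<open>x \<le> y\<close>])
    fix r assume "x < r" "r < y"
    then show "\<exists>d. (W has_real_derivative d) (at r) \<and> d \<ge> 0"
      using that W_deriv[of r] W'_nonneg[of r] by auto
  qed (use W_cont that in \<open>auto intro: continuous_on_subset\<close>)
  have ratio: "u t / v t \<ge> u 0 / v 0" if t: "0 \<le> t" "t < b" for t
  proof -
    define g where "g t = u t / v t - 1" for t
    have g_pos_iff: "g r > 0 \<longleftrightarrow> v r < u r" if "0 \<le> r" "r < b" for r
      using vpos[of r] that b by (simp add: g_def)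
    have "g t \<ge> g 0"
    proof (rule ge_initial_if_nondecreasing_while_positive[where g = g])
      show "continuous_on {0..t} g"
        unfolding g_def using t b ab
        by (intro continuous_intros sol_cont(1)[OF u] sol_cont(1)[OF v]) (auto simp: less_imp_neq[OF vpos, symmetric])
      show "g 0 > 0" using g_pos_iff[of 0] b less0 by simp
      show "t \<in> {0..t}" using t by simp
      fix r assume r: "0 < r" "r < t"
      have vr: "v r > 0" using r t b by (intro vpos) auto
      show "(g has_real_derivative ((du r * v r - u r * dv r) / (v r * v r)) - 0) (at r)"
        unfolding g_def using vr t r b ab
        by (intro DERIV_diff DERIV_divide sol_deriv(1)[OF u] sol_deriv(1)[OF v] DERIV_const) auto
      assume pos: "\<And>s. 0 \<le> s \<Longrightarrow> s \<le> r \<Longrightarrow> g s > 0"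
      have "v s \<le> u s" if "0 \<le> s" "s \<le> r" for s
        using pos[OF that] g_pos_iff[of s] that r t by auto
      then have "0 \<le> W r" using W_mono[of 0 r] W0 r t by auto
      moreover have "r ^ (n - 1) > 0" using r by simp
      ultimately have "du r * v r - u r * dv r \<ge> 0"
        by (auto simp: W_def zero_le_mult_iff)
      then show "(du r * v r - u r * dv r) / (v r * v r) - 0 \<ge> 0" by simp
    qed
    then show ?thesis by (simp add: g_def)
  qed
  \<comment> \<open>Retaining the factor \<open>q > 1\<close>, and not just the order of
    \<open>u\<close> and \<open>v\<close>, leaves a gap between the two heights in which the strict
    height \<open>s\<close> can be placed.\<close>
  define q where "q = u 0 / v 0"
  have q: "q > 1" using less0 by (simp add: q_def)
  have above: "u t \<ge> q * v t" if t: "0 \<le> t" "t < b" for t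
    using ratio[OF t] vpos[of t] t b by (simp add: q_def[symmetric] pos_le_divide_eq)
  have above_strict: "u t > v t" if t: "0 \<le> t" "t < b" for t
  proof -
    have "v t < q * v t" using q vpos[of t] t b by simp
    then show ?thesis using above[OF t] by linarith
  qed
  show less: "bv < bu"
  proof (rule ccontr)
    assume "\<not> bv < bu"
    then have bu: "b = bu" by (simp add: b_def)
    have "continuous_on {0..b} (\<lambda>t. u t - q * v t)"
      using b ab by (intro continuous_intros sol_cont(1)[OF u] sol_cont(1)[OF v]) auto
    moreover have "\<And>t. t \<in> {0..<b} \<Longrightarrow> u t - q * v t \<ge> 0" using above by auto
    ultimately have "u b - q * v b \<ge> 0"
      using continuous_ge_on_closure[of "{0..<b}" "\<lambda>t. u t - q * v t" b 0] b by simp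
    then have "q * v bu \<le> 0" using end_points bu by simp
    then have "v bu \<le> 0" using q by (simp add: mult_le_0_iff)
    then have bv: "bv = bu" using vpos[of bu] b bu by force
    then have Wb: "W b = 0" using end_points bu by (simp add: W_def)
    \<comment> \<open>\<open>W\<close> is monotone and vanishes at both ends of the
      interval.\<close>
    have W_zero: "W t = 0" if "0 \<le> t" "t \<le> b" for t
      using W_mono[of 0 t] W_mono[of t b] that W0 Wb above_strict by (simp add: less_imp_le order.antisym)
    have eq: "u t * f (v t) = f (u t) * v t" if t: "0 < t" "t < b" for t
    proof -
      have "t ^ (n - 1) * (u t * f (v t) - f (u t) * v t) = 0"
      proof (rule DERIV_local_const[OF W_deriv[OF t]])
        show "min t (b - t) > 0" using t by simp
        show "\<forall>r. \<bar>t - r\<bar> < min t (b - t) \<longrightarrow> W t = W r"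
        proof (intro allI impI)
          fix r assume "\<bar>t - r\<bar> < min t (b - t)"
          then have "0 \<le> r" "r \<le> b" by linarith+
          then show "W t = W r" using W_zero t by simp
        qed
      qed
      then show ?thesis using t by simp
    qed
    obtain s where s: "0 < s" "s < v 0" and
      strict: "\<And>x y. 0 < x \<Longrightarrow> x < s \<Longrightarrow> s < y \<Longrightarrow> f y * x < f x * y"
      using f_antimono_quotient_strict_near_0[OF less0(1)] by blast
    \<comment> \<open>This choice gives \<open>m < s < q * m\<close>. Where \<open>v\<close> has
      height \<open>m\<close>, \<open>u\<close> has at least height \<open>q * m\<close>, so the two
      heights lie on opposite sides of \<open>s\<close>.\<close>
    define m where "m = 2 / (1 + q) * s"
    have m: "0 < m" "m < s" "s < q * m"
      using s q by (auto simp: m_def field_simps)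
    have "\<exists>r\<ge>0. r \<le> b \<and> v r = m"
      using m s end_points bu bv b ab by (intro IVT2' sol_cont(1)[OF v]) auto
    then obtain r where r: "0 \<le> r" "r \<le> b" "v r = m" by blast
    then have "r \<noteq> 0" "r \<noteq> b" using m s end_points bu bv by auto
    then show False
      using strict[of "v r" "u r"] eq[of r] above[of r] r m by (auto simp: mult.commute)
  qed
  fix t assume "0 \<le> t" "t \<le> bv"
  then show "v t < u t"
    using above_strict[of t] upos[of bv] less end_points ab by (cases "t = bv") (auto simp: b_def)
qed

text \<open>On the descending branches the slope difference \<open>D\<close> is taken at equal
  heights. It is positive at the top of \<open>v\<close>, where \<open>u\<close>, having the higher
  top, is already descending through that height. By \<open>above\<close>, \<open>u\<close> reaches
  each height later than \<open>v\<close>; its weaker damping keeps \<open>D\<close> from vanishing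
  up to height 0, which is the claim.\<close>

lemma steeper_descent:
  assumes hu: "hump u du au cu bu" and hv: "hump v dv av cv bv"
    and "bv < bu" "bu < \<rho>" and top: "v cv < u cu"
    and above: "\<And>t. cv \<le> t \<Longrightarrow> t \<le> bv \<Longrightarrow> cu \<le> t \<Longrightarrow> v t < u t"
  shows "du bu < dv bv"
proof -
  have u: "sol u du" and v: "sol v dv"
    and ab: "0 \<le> au" "au \<le> cu" "cu < bu" "0 \<le> av" "av \<le> cv" "cv < bv"
    and u_decr: "\<And>t. cu < t \<Longrightarrow> t \<le> bu \<Longrightarrow> du t < 0"
    and v_decr: "\<And>t. cv < t \<Longrightarrow> t \<le> bv \<Longrightarrow> dv t < 0"
    and vpos: "\<And>t. av < t \<Longrightarrow> t < bv \<Longrightarrow> v t > 0"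
    and vals: "u bu = 0" "v bv = 0" "dv cv = 0"
    using hu hv by (auto simp: hump_def)
  \<comment> \<open>The descending branch of \<open>u\<close> is prolonged slightly beyond
    \<open>bu\<close>, so that height 0 lies inside the range on which its inverse is
    differentiable. There is room for this because \<open>bu < \<rho>\<close>.\<close>
  have "isCont du bu"
    using sol_deriv(2)[OF u, of bu] ab \<open>bu < \<rho>\<close> by (auto intro: DERIV_isCont)
  then obtain d where d: "d > 0" "\<And>t. \<bar>t - bu\<bar> < d \<Longrightarrow> du t < 0"
    using isCont_neg_neighbourhood[where g = du and x = bu] u_decr[of bu] ab by auto
  obtain b' where b': "bu < b'" "b' < \<rho>" "b' < bu + d"
    using dense[of bu "min \<rho> (bu + d)"] d \<open>bu < \<rho>\<close> by auto
  have du_neg: "du t < 0" if "cu < t" "t \<le> b'" for t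
    using u_decr[of t] d(2)[of t] that b' by (cases "t \<le> bu") auto
  have u_dec: "u y < u x" if "cu \<le> x" "x < y" "y \<le> b'" for x y
  proof (rule DERIV_neg_imp_decreasing_open[where f = u, OF \<open>x < y\<close>])
    fix t assume t: "x < t" "t < y"
    then show "\<exists>d. (u has_real_derivative d) (at t) \<and> d < 0"
      using that ab b' by (intro exI[of _ "du t"] conjI sol_deriv(1)[OF u] du_neg) auto
  qed (use that ab b' in \<open>auto intro: sol_cont(1)[OF u]\<close>)
  have u_b': "u b' < 0" using u_dec[of bu b'] vals ab b' by auto
  obtain R where R_cont: "continuous_on {- u cu..- u b'} R"
    and R: "\<And>s. s \<in> {- u cu..- u b'} \<Longrightarrow> R s \<in> {cu..b'} \<and> - u (R s) = s"
    and R_deriv: "\<And>s. - u cu < s \<Longrightarrow> s < - u b' \<Longrightarrow>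
       cu < R s \<and> R s < b' \<and> (R has_real_derivative 1 / - du (R s)) (at s)"
  proof (rule inverse_of_increasing[of cu b' "\<lambda>t. - u t" "\<lambda>t. - du t"])
    show "cu < b'" using ab b' by simp
    show "continuous_on {cu..b'} (\<lambda>t. - u t)"
      using ab b' by (intro continuous_intros sol_cont(1)[OF u]) auto
    show "((\<lambda>t. - u t) has_real_derivative - du t) (at t)" if "cu < t" "t < b'" for t
      using that ab b' by (intro DERIV_minus sol_deriv(1)[OF u]) auto
    show "- du t > 0" if "cu < t" "t < b'" for t
      using du_neg[of t] that by simp
  qed blast
  \<comment> \<open>The radius at which the descending branch of \<open>u\<close> has the height
    \<open>v t\<close>; \<open>R\<close> inverts \<open>- u\<close>, which increases on that
    branch.\<close>
  define \<phi> where "\<phi> t = R (- v t)" for t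
  have v_range: "- u cu < - v t" "- v t < - u b'" if "cv \<le> t" "t \<le> bv" for t
  proof -
    have "v t \<le> v cv" using hump_max[OF hv, of t] that ab by simp
    then show "- u cu < - v t" using top by simp
    have "v t \<ge> 0"
      using hump_decreasing[OF hv, of t bv] that vals by (cases "t = bv") auto
    then show "- v t < - u b'" using u_b' by simp
  qed
  have \<phi>: "cu < \<phi> t" "\<phi> t < b'" "u (\<phi> t) = v t"
    "(R has_real_derivative 1 / - du (\<phi> t)) (at (- v t))" if "cv \<le> t" "t \<le> bv" for t
    using R[of "- v t"] R_deriv[of "- v t"] v_range[OF that] by (auto simp: \<phi>_def)
  have \<phi>_gt: "t < \<phi> t" if t: "cv \<le> t" "t \<le> bv" for t
  proof (rule ccontr)
    assume "\<not> t < \<phi> t"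
    then have "u t \<le> v t"
      using u_dec[of "\<phi> t" t] \<phi>[OF t] t b' \<open>bv < bu\<close> by (cases "\<phi> t = t") auto
    then show False
      using above[OF t] \<phi>[OF t] \<open>\<not> t < \<phi> t\<close> by auto
  qed
  have "\<phi> bv = bu"
  proof -
    have "u (\<phi> bv) = u bu" "cu \<le> \<phi> bv" "\<phi> bv \<le> b'" using \<phi>[of bv] vals ab by auto
    then show ?thesis
      using u_dec[of "\<phi> bv" bu] u_dec[of bu "\<phi> bv"] ab b' by (cases "\<phi> bv" bu rule: linorder_cases) auto
  qed
  define D where "D t = dv t - du (\<phi> t)" for t
  have D_cont: "continuous_on {cv..bv} D"
  proof -
    have "continuous_on {cv..bv} \<phi>"
      unfolding \<phi>_def
    proof (rule continuous_on_compose2[OF R_cont])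
      show "continuous_on {cv..bv} (\<lambda>t. - v t)"
        using ab \<open>bv < bu\<close> \<open>bu < \<rho>\<close> by (intro continuous_on_minus sol_cont(1)[OF v]) auto
      show "(\<lambda>t. - v t) ` {cv..bv} \<subseteq> {- u cu..- u b'}"
        using v_range by (auto simp: less_imp_le)
    qed
    then have "continuous_on {cv..bv} (\<lambda>t. du (\<phi> t))"
      using \<phi>(1,2) ab b'
      by (intro continuous_on_compose2[OF sol_cont(2)[OF u, of cu b']]) (auto simp: less_imp_le)
    then show ?thesis
      unfolding D_def using ab \<open>bv < bu\<close> \<open>bu < \<rho>\<close>
      by (intro continuous_on_diff sol_cont(2)[OF v]) auto
  qed
  have "D bv > 0"
  proof (rule ccontr)
    assume "\<not> D bv > 0"
    moreover have "D cv > 0" using \<phi>[of cv] du_neg[of "\<phi> cv"] vals ab by (auto simp: D_def)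
    ultimately obtain s where s: "cv < s" "s \<le> bv" "D s = 0"
      and before: "\<And>r. cv \<le> r \<Longrightarrow> r < s \<Longrightarrow> D r > 0"
      using first_zero[OF D_cont, of bv] ab by auto
    have s_pos: "0 < s" "s < \<rho>" "0 < \<phi> s" "\<phi> s < \<rho>"
      using s \<phi>[of s] ab b' \<open>bv < bu\<close> by auto
    have dv_s: "dv s < 0" "du (\<phi> s) = dv s" using s v_decr[of s] by (auto simp: D_def)
    have "(\<phi> has_real_derivative 1 / - du (\<phi> s) * - dv s) (at s)"
      unfolding \<phi>_def using \<phi>(4)[of s] s s_pos
      by (intro DERIV_chain2[where f = R] DERIV_minus sol_deriv(1)[OF v]) (auto simp: \<phi>_def)
    \<comment> \<open>At \<open>s\<close> the slopes agree, so \<open>\<phi>\<close> has derivative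
      1 and the forcing terms cancel. The damping terms leave a positive derivative, and
      \<open>D\<close> would be negative just before its first zero.\<close>
    then have "(\<phi> has_real_derivative 1) (at s)" using dv_s by simp
    then have "(D has_real_derivative
        (- ((real n - 1) / s * dv s) - f (v s)) - (- ((real n - 1) / \<phi> s * du (\<phi> s)) - f (u (\<phi> s))) * 1) (at s)"
      unfolding D_def using s_pos
      by (intro DERIV_diff DERIV_chain2[where f = du] sol_deriv(2)[OF u] sol_deriv(2)[OF v]) auto
    moreover have "(- ((real n - 1) / s * dv s) - f (v s)) - (- ((real n - 1) / \<phi> s * du (\<phi> s)) - f (u (\<phi> s))) * 1
        = (real n - 1) * - dv s * (1 / s - 1 / \<phi> s)"
      using dv_s \<phi>(3)[of s] s by (simp add: algebra_simps diff_divide_distrib)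
    moreover have "1 / s - 1 / \<phi> s > 0" using \<phi>_gt[of s] s s_pos by (simp add: field_simps)
    then have "(real n - 1) * - dv s * (1 / s - 1 / \<phi> s) > 0"
      using dv_s n_ge_2 by (intro mult_pos_pos) auto
    ultimately obtain e where e: "e > 0" "\<And>h. h > 0 \<Longrightarrow> h < e \<Longrightarrow> D (s - h) < D s"
      using DERIV_pos_inc_left[of D _ s] by metis
    obtain h where h: "h > 0" "h < e" "h < s - cv"
      using dense[of 0 "min e (s - cv)"] e s by auto
    then show False using e(2)[of h] before[of "s - h"] s by auto
  qed
  then show ?thesis using \<open>\<phi> bv = bu\<close> by (simp add: D_def)
qed

text \<open>The expression \<open>v (min y cv)\<close> is \<open>v\<close> frozen at its maximum
  once its top is passed. So at \<open>y\<close>, \<open>u\<close> either meets the ascending branch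
  of \<open>v\<close> or attains the maximal height of \<open>v\<close>, in both cases with the
  larger slope. If \<open>u\<close> remained below this envelope up to its own top, its slope excess
  at equal heights would still be positive there, which \<open>du cu = 0\<close> excludes.\<close>

lemma faster_ascent:
  assumes hu: "hump u du au cu bu" and hv: "hump v dv av cv bv"
    and "0 < av" "av < au" "u au = 0" "v av = 0" and slope: "0 < dv av" "dv av < du au"
  obtains y where "au < y" "y < cu" "u y = v (min y cv)" "dv (min y cv) < du y"
proof -
  have u: "sol u du" and v: "sol v dv"
    and ab: "0 \<le> au" "au \<le> cu" "cu < bu" "0 \<le> av" "av \<le> cv" "cv < bv" "bu \<le> \<rho>" "bv \<le> \<rho>"
    and u_incr: "\<And>t. au \<le> t \<Longrightarrow> t < cu \<Longrightarrow> du t > 0"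
    and v_incr: "\<And>t. av \<le> t \<Longrightarrow> t < cv \<Longrightarrow> dv t > 0"
    and upos: "\<And>t. au < t \<Longrightarrow> t < bu \<Longrightarrow> u t > 0"
    and vpos: "\<And>t. av < t \<Longrightarrow> t < bv \<Longrightarrow> v t > 0"
    and crit: "du cu = 0" "dv cv = 0"
    using hu hv by (auto simp: hump_def)
  have cv: "av < cv" and cu: "au < cu" using slope crit ab by (auto simp: le_less)
  obtain R where R_cont: "continuous_on {v av..v cv} R"
    and R_left: "\<And>t. t \<in> {av..cv} \<Longrightarrow> R (v t) = t"
    and R: "\<And>s. s \<in> {v av..v cv} \<Longrightarrow> R s \<in> {av..cv} \<and> v (R s) = s"
    and R_deriv: "\<And>s. v av < s \<Longrightarrow> s < v cv \<Longrightarrow>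
       av < R s \<and> R s < cv \<and> (R has_real_derivative 1 / dv (R s)) (at s)"
  proof (rule inverse_of_increasing[of av cv v dv])
    show "continuous_on {av..cv} v" using ab by (intro sol_cont(1)[OF v]) auto
    show "(v has_real_derivative dv t) (at t)" if "av < t" "t < cv" for t
      using that ab by (intro sol_deriv(1)[OF v]) auto
    show "dv t > 0" if "av < t" "t < cv" for t
      using v_incr[of t] that by simp
  qed (use cv in blast)+
  define env where "env t = v (min t cv)" for t
  define g where "g t = env t - u t" for t
  \<comment> \<open>The radius at which the ascending branch of \<open>v\<close> has the height
    \<open>u t\<close>; it is meaningful as long as \<open>u\<close> does not exceed the
    envelope.\<close>
  define \<psi> where "\<psi> t = R (u t)" for t
  define D where "D t = du t - dv (\<psi> t)" for t
  have g_cont: "continuous_on {au..cu} g"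
    unfolding g_def env_def using ab cv \<open>0 < av\<close> \<open>av < au\<close>
    by (intro continuous_on_diff sol_cont(1)[OF u]
        continuous_on_compose2[OF sol_cont(1)[OF v, of av cv]] continuous_intros) auto
  have g_start: "g au > 0"
    using vpos[of "min au cv"] cv ab \<open>av < au\<close> \<open>u au = 0\<close> by (auto simp: g_def env_def)
  have env_le: "env t \<le> v cv" if "av \<le> t" for t
    using hump_max[OF hv, of "min t cv"] that ab by (auto simp: env_def)
  have u_nonneg: "u t \<ge> 0" if "au \<le> t" "t \<le> cu" for t
    using upos[of t] \<open>u au = 0\<close> that ab by (cases "t = au") auto
  have \<psi>: "av \<le> \<psi> t" "\<psi> t \<le> cv" "v (\<psi> t) = u t"
    if "au \<le> t" "t \<le> cu" "g t \<ge> 0" for t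
    using R[of "u t"] u_nonneg[of t] env_le[of t] that \<open>v av = 0\<close> \<open>av < au\<close>
    by (auto simp: \<psi>_def g_def)
  have D_start: "D au > 0"
    using R_left[of av] slope ab \<open>u au = 0\<close> \<open>v av = 0\<close> by (simp add: D_def \<psi>_def)
  \<comment> \<open>As long as \<open>u\<close> lags behind \<open>v\<close> it is subject to less damping, so its excess slope, measured at
    equal heights, cannot decrease.\<close>
  have D_ge: "D T \<ge> D au"
    if T: "au \<le> T" "T \<le> cu" "g T \<ge> 0" and before: "\<And>t. au \<le> t \<Longrightarrow> t < T \<Longrightarrow> g t > 0" for T
  proof (rule ge_initial_if_nondecreasing_while_positive[where g = D])
    have gT: "g t \<ge> 0" if "au \<le> t" "t \<le> T" for t
      using before[of t] that T by (cases "t = T") auto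
    have "continuous_on {au..T} \<psi>"
      unfolding \<psi>_def
    proof (rule continuous_on_compose2[OF R_cont])
      show "continuous_on {au..T} u" using T ab by (intro sol_cont(1)[OF u]) auto
      show "u ` {au..T} \<subseteq> {v av..v cv}"
      proof
        fix s assume "s \<in> u ` {au..T}"
        then obtain t where "au \<le> t" "t \<le> T" "s = u t" by auto
        then show "s \<in> {v av..v cv}"
          using u_nonneg[of t] env_le[of t] gT[of t] T \<open>v av = 0\<close> \<open>av < au\<close> by (simp add: g_def)
      qed
    qed
    then have "continuous_on {au..T} (\<lambda>t. dv (\<psi> t))"
      using \<psi> T gT ab by (intro continuous_on_compose2[OF sol_cont(2)[OF v, of av cv]]) auto
    then show "continuous_on {au..T} D"
      unfolding D_def using T ab by (intro continuous_on_diff sol_cont(2)[OF u]) auto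
    show "D au > 0" by (rule D_start)
    show "T \<in> {au..T}" using T by simp
    fix t assume t: "au < t" "t < T"
    have ut: "0 < u t" "u t < env t" "env t \<le> v cv"
      using upos[of t] before[of t] env_le[of t] t T ab \<open>av < au\<close> by (auto simp: g_def)
    have \<psi>t: "av < \<psi> t" "\<psi> t < cv" "v (\<psi> t) = u t"
      and R': "(R has_real_derivative 1 / dv (\<psi> t)) (at (u t))"
      using R_deriv[of "u t"] R[of "u t"] ut \<open>v av = 0\<close> by (auto simp: \<psi>_def)
    have dv_pos: "dv (\<psi> t) > 0" using \<psi>t v_incr[of "\<psi> t"] by simp
    have lag: "\<psi> t < t"
    proof (rule ccontr)
      assume "\<not> \<psi> t < t"
      then have "env t \<le> v (\<psi> t)"
        using hump_increasing[OF hv, of t "\<psi> t"] \<psi>t t \<open>av < au\<close> by (cases "t = \<psi> t") (auto simp: env_def)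
      then show False using ut \<psi>t by simp
    qed
    have t_in: "0 < t" "t < \<rho>" "0 < \<psi> t" "\<psi> t < \<rho>" using t T ab \<psi>t by auto
    have "(\<psi> has_real_derivative 1 / dv (\<psi> t) * du t) (at t)"
      unfolding \<psi>_def using R' t_in
      by (intro DERIV_chain2[where f = R] sol_deriv(1)[OF u]) (auto simp: \<psi>_def)
    then show "(D has_real_derivative
        (- ((real n - 1) / t * du t) - f (u t))
          - (- ((real n - 1) / \<psi> t * dv (\<psi> t)) - f (v (\<psi> t))) * (1 / dv (\<psi> t) * du t)) (at t)"
      unfolding D_def using t_in
      by (intro DERIV_diff DERIV_chain2[where f = dv] sol_deriv(2)[OF u] sol_deriv(2)[OF v]) auto
    assume pos: "\<And>r. au \<le> r \<Longrightarrow> r \<le> t \<Longrightarrow> D r > 0"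
    have "du t > dv (\<psi> t)" using pos[of t] t by (simp add: D_def)
    \<comment> \<open>The first summand is nonnegative because \<open>\<psi> t < t\<close>, the
      second because the slope of \<open>u\<close> is still the larger one at this height.\<close>
    then have "(real n - 1) * du t * (1 / \<psi> t - 1 / t) + f (u t) * (du t / dv (\<psi> t) - 1) \<ge> 0"
      using n_ge_2 dv_pos lag t_in f_pos[of "u t"] ut
      by (intro add_nonneg_nonneg mult_nonneg_nonneg) (auto simp: field_simps)
    also have "(real n - 1) * du t * (1 / \<psi> t - 1 / t) + f (u t) * (du t / dv (\<psi> t) - 1)
      = (- ((real n - 1) / t * du t) - f (u t))
          - (- ((real n - 1) / \<psi> t * dv (\<psi> t)) - f (v (\<psi> t))) * (1 / dv (\<psi> t) * du t)"
      using dv_pos \<psi>t t_in by (simp add: field_simps)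
    finally show "(- ((real n - 1) / t * du t) - f (u t))
          - (- ((real n - 1) / \<psi> t * dv (\<psi> t)) - f (v (\<psi> t))) * (1 / dv (\<psi> t) * du t) \<ge> 0" .
  qed
  have "\<exists>t\<in>{au..cu}. g t \<le> 0"
  proof (rule ccontr)
    assume "\<not> ?thesis"
    then have all: "\<And>t. au \<le> t \<Longrightarrow> t \<le> cu \<Longrightarrow> g t > 0" by force
    then have "D cu \<ge> D au" using cu by (intro D_ge) (auto intro: less_imp_le)
    moreover have "dv (\<psi> cu) \<ge> 0"
      using \<psi>[of cu] all[of cu] cu v_incr[of "\<psi> cu"] crit by (cases "\<psi> cu = cv") auto
    ultimately show False using D_start crit by (simp add: D_def)
  qed
  then obtain y where y: "au < y" "y \<le> cu" "g y = 0" "\<And>r. au \<le> r \<Longrightarrow> r < y \<Longrightarrow> g r > 0"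
    using first_zero[OF g_cont g_start] by (metis atLeastAtMost_iff order.trans)
  have eq: "u y = v (min y cv)" using y by (simp add: g_def env_def)
  have "D y > 0" using D_ge[of y] D_start y by simp
  moreover have "\<psi> y = min y cv"
    using R_left[of "min y cv"] eq y cv \<open>av < au\<close> by (simp add: \<psi>_def)
  ultimately have slope_y: "dv (min y cv) < du y" by (simp add: D_def)
  moreover have "dv (min y cv) \<ge> 0"
    using v_incr[of y] crit y \<open>av < au\<close> by (auto simp: min_def less_imp_le le_less)
  ultimately have "y \<noteq> cu" using crit by auto
  then show thesis using that[OF y(1) _ eq slope_y] y by simp
qed

text \<open>The ascent yields a point \<open>y\<close> before the top of \<open>u\<close>. If
  \<open>v\<close> has reached its zero by then, it is clearly the earlier one; otherwise
  \<open>u\<close> overtakes \<open>v\<close> at \<open>y\<close> with positive Wronskian. Either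
  way \<open>u\<close> has the higher top and lies above \<open>v\<close> where both descend, as the
  comparison of descents demands.\<close>

lemma next_zero_later_and_steeper:
  assumes hu: "hump u du au cu bu" and hv: "hump v dv av cv bv"
    and "0 < av" "av < au" "u au = 0" "v av = 0" and slope: "0 < dv av" "dv av < du au"
  shows "bv < bu" and "bu < \<rho> \<Longrightarrow> du bu < dv bv"
proof -
  have ab: "0 \<le> au" "au \<le> cu" "cu < bu" "0 \<le> av" "av \<le> cv" "cv < bv" "bu \<le> \<rho>" "bv \<le> \<rho>"
    and u_incr: "\<And>t. au \<le> t \<Longrightarrow> t < cu \<Longrightarrow> du t > 0"
    and v_decr: "\<And>t. cv < t \<Longrightarrow> t \<le> bv \<Longrightarrow> dv t < 0"
    and vpos: "\<And>t. av < t \<Longrightarrow> t < bv \<Longrightarrow> v t > 0"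
    and upos: "\<And>t. au < t \<Longrightarrow> t < bu \<Longrightarrow> u t > 0"
    using hu hv by (auto simp: hump_def)
  obtain y where y: "au < y" "y < cu" and eq: "u y = v (min y cv)" and sl: "dv (min y cv) < du y"
    using faster_ascent[OF assms] by blast
  have top: "v cv < u cu" if "cv \<le> y"
    using hump_increasing[OF hu, of y cu] y eq that by (simp add: min.absorb2)
  have "bv < bu \<and> v cv < u cu \<and> (\<forall>t. cv \<le> t \<longrightarrow> t \<le> bv \<longrightarrow> cu \<le> t \<longrightarrow> v t < u t)"
  proof (cases "y < bv")
    case False
    then show ?thesis using top y ab by auto
  next
    case True
    have "v y > 0" "u y > 0" using vpos[of y] upos[of y] True y ab \<open>av < au\<close> by auto
    have ge: "v y \<le> u y"
      using hump_max[OF hv, of y] eq True y \<open>av < au\<close> by (auto simp: min_def split: if_splits)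
    \<comment> \<open>Up to the top of \<open>v\<close> the heights at \<open>y\<close> agree and
      the slopes decide; beyond it \<open>v\<close> descends while \<open>u\<close> still
      ascends.\<close>
    have W: "du y * v y - u y * dv y > 0"
    proof (cases "y \<le> cv")
      case True
      then show ?thesis using eq sl \<open>v y > 0\<close> by (simp add: min_def mult.commute)
    next
      case False
      then have "u y * dv y < 0" "du y * v y > 0"
        using v_decr[of y] u_incr[of y] \<open>v y > 0\<close> \<open>u y > 0\<close> \<open>y < bv\<close> y
        by (auto simp: mult_less_0_iff)
      then show ?thesis by linarith
    qed
    have "y < bu" "av < y" using y ab \<open>av < au\<close> by auto
    note later = later_zero_if_overtaken[OF hu hv \<open>au < y\<close> this True ge W]
    moreover have "v cv < u cu"
    proof (cases "cv \<le> y")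
      case False
      then have "v cv < u cv" using later(2)[of cv] ab by simp
      also have "u cv \<le> u cu" using hump_max[OF hu, of cv] False y ab later(1) by simp
      finally show ?thesis .
    qed (rule top)
    ultimately show ?thesis using y by auto
  qed
  then show "bv < bu" and "bu < \<rho> \<Longrightarrow> du bu < dv bv"
    using steeper_descent[OF hu hv] by auto
qed

lemma first_zero_later_and_steeper:
  assumes hu: "hump u du 0 0 bu" and hv: "hump v dv 0 0 bv" and less0: "0 < v 0" "v 0 < u 0"
  shows "bv < bu" and "bu < \<rho> \<Longrightarrow> du bu < dv bv"
  using later_zero_from_centre[OF assms] steeper_descent[OF hu hv] less0 by auto

section \<open>Counting zeros\<close>

definition zeros_after :: "(real \<Rightarrow> real) \<Rightarrow> real \<Rightarrow> real set" where
  "zeros_after u a = {t \<in> {a<..<\<rho>}. u t = 0}"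

text \<open>The least interior zero after \<open>a\<close>, with \<open>\<rho>\<close> as the
  default when none is left. The assumption \<open>start\<close> fixes the sign in a way that fits
  both a zero with positive slope and a positive value at the centre.\<close>

lemma next_zero:
  assumes u: "sol u du" and "0 \<le> a" "a < \<rho>" "u \<rho> = 0" and fin: "finite (zeros_after u a)"
    and start: "\<And>t. a < t \<Longrightarrow> \<exists>s. a < s \<and> s < t \<and> u s > 0"
  obtains b where "a < b" "b \<le> \<rho>" "u b = 0" "\<And>t. a < t \<Longrightarrow> t < b \<Longrightarrow> u t > 0"
    "zeros_after u a = {} \<Longrightarrow> b = \<rho>"
    "zeros_after u a \<noteq> {} \<Longrightarrow> b < \<rho> \<and> zeros_after u b = zeros_after u a - {b} \<and> b \<in> zeros_after u a"
proof -
  define b where "b = Min (insert \<rho> (zeros_after u a))"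
  have b_in: "b \<in> insert \<rho> (zeros_after u a)"
    unfolding b_def by (rule Min_in) (use fin in auto)
  have b_le: "b \<le> t" if "t \<in> insert \<rho> (zeros_after u a)" for t
    unfolding b_def by (rule Min_le) (use fin that in auto)
  have ab: "a < b" "b \<le> \<rho>" "u b = 0"
    using b_in b_le \<open>a < \<rho>\<close> \<open>u \<rho> = 0\<close> by (auto simp: zeros_after_def)
  have nz: "u t \<noteq> 0" if "a < t" "t < b" for t
    using b_le[of t] that ab by (auto simp: zeros_after_def)
  obtain s where s: "a < s" "s < b" "u s > 0" using start[OF \<open>a < b\<close>] by blast
  have "continuous_on {a<..<b} u"
    using sol_cont(1)[OF u \<open>0 \<le> a\<close> \<open>b \<le> \<rho>\<close>] by (rule continuous_on_subset) auto
  then have pos: "u t > 0" if "a < t" "t < b" for t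
    using constant_sign_if_no_zeros[of a b u s t] nz s that by blast
  have "b = \<rho>" if "zeros_after u a = {}" using b_in that by auto
  moreover have "b < \<rho> \<and> zeros_after u b = zeros_after u a - {b} \<and> b \<in> zeros_after u a"
    if ne: "zeros_after u a \<noteq> {}"
  proof -
    obtain z where z: "z \<in> zeros_after u a" using ne by blast
    then have "b < \<rho>" using b_le[of z] by (auto simp: zeros_after_def)
    moreover have "zeros_after u b = zeros_after u a - {b}"
      using b_le ab by (force simp: zeros_after_def)
    ultimately show ?thesis using b_in by auto
  qed
  ultimately show thesis using that[OF ab pos] by blast
qed

lemma sol_pos_right_of_zero:
  assumes u: "sol u du" and "0 < a" "a < \<rho>" "u a = 0" "du a > 0" "a < t"
  shows "\<exists>s. a < s \<and> s < t \<and> u s > 0"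
proof -
  obtain d where d: "d > 0" "\<And>h. h > 0 \<Longrightarrow> h < d \<Longrightarrow> u a < u (a + h)"
    using DERIV_pos_inc_right[OF sol_deriv(1)[OF u \<open>0 < a\<close> \<open>a < \<rho>\<close>] \<open>du a > 0\<close>] by blast
  obtain h where "0 < h" "h < min d (t - a)"
    using dense[of 0 "min d (t - a)"] d \<open>a < t\<close> by auto
  then show ?thesis using d(2)[of h] \<open>u a = 0\<close> by (intro exI[of _ "a + h"]) auto
qed

lemma zeros_after_uminus: "zeros_after (\<lambda>t. - u t) a = zeros_after u a"
  by (simp add: zeros_after_def)

text \<open>The counting step shared by the centre and the interior zeros. As
  \<open>bv < bu \<le> \<rho>\<close>, \<open>v\<close> has an interior zero left, and equal counts
  would give \<open>u\<close> one too. Removing the first zero from each set reduces the claim to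
  \<open>rest\<close>, whose last premise provides the decrease for an induction.\<close>

lemma different_zero_counts_step:
  assumes fin: "finite (zeros_after u au)" "finite (zeros_after v av)"
    and later: "bv < bu" "bu \<le> \<rho>"
    and v_last: "zeros_after v av = {} \<Longrightarrow> bv = \<rho>"
    and u_rest: "zeros_after u au \<noteq> {} \<Longrightarrow>
      bu < \<rho> \<and> zeros_after u bu = zeros_after u au - {bu} \<and> bu \<in> zeros_after u au"
    and v_rest: "zeros_after v av \<noteq> {} \<Longrightarrow>
      bv < \<rho> \<and> zeros_after v bv = zeros_after v av - {bv} \<and> bv \<in> zeros_after v av"
    and rest: "\<lbrakk>bu < \<rho>; finite (zeros_after u bu); finite (zeros_after v bv);
      card (zeros_after u bu) < card (zeros_after u au)\<rbrakk>
      \<Longrightarrow> card (zeros_after u bu) \<noteq> card (zeros_after v bv)"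
  shows "card (zeros_after u au) \<noteq> card (zeros_after v av)"
proof
  assume eq: "card (zeros_after u au) = card (zeros_after v av)"
  have vne: "zeros_after v av \<noteq> {}" using v_last later by auto
  then have une: "zeros_after u au \<noteq> {}" using eq fin by (metis card.empty card_0_eq)
  have "card (zeros_after u au) = Suc (card (zeros_after u bu))"
    using card.remove[OF fin(1)] u_rest[OF une] by metis
  moreover have "card (zeros_after v av) = Suc (card (zeros_after v bv))"
    using card.remove[OF fin(2)] v_rest[OF vne] by metis
  moreover have "finite (zeros_after u bu)" "finite (zeros_after v bv)"
    using u_rest[OF une] v_rest[OF vne] fin by simp_all
  ultimately show False using rest u_rest[OF une] eq by simp
qed

text \<open>Induction on the number of zeros of \<open>u\<close> still to come. Negating both
  solutions after each zero makes the next humps positive and turns the steeper descent into the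
  steeper ascent required of the slopes.\<close>

lemma different_zero_counts:
  assumes "sol u du" "sol v dv" "0 < av" "av < au" "au < \<rho>"
    and "u au = 0" "v av = 0" "0 < dv av" "dv av < du au" "u \<rho> = 0" "v \<rho> = 0"
    and "finite (zeros_after u au)" "finite (zeros_after v av)"
  shows "card (zeros_after u au) \<noteq> card (zeros_after v av)"
  using assms
proof (induction "card (zeros_after u au)" arbitrary: u du v dv au av rule: less_induct)
  case (less u au du v dv av)
  note u = \<open>sol u du\<close> and v = \<open>sol v dv\<close>
  note slopes = \<open>0 < dv av\<close> \<open>dv av < du au\<close> and order = \<open>0 < av\<close> \<open>av < au\<close> \<open>au < \<rho>\<close>
    and starts = \<open>u au = 0\<close> \<open>v av = 0\<close> and ends = \<open>u \<rho> = 0\<close> \<open>v \<rho> = 0\<close>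
    and fin = \<open>finite (zeros_after u au)\<close> \<open>finite (zeros_after v av)\<close>
  obtain bu where bu: "au < bu" "bu \<le> \<rho>" "u bu = 0" "\<And>t. au < t \<Longrightarrow> t < bu \<Longrightarrow> u t > 0"
    "zeros_after u au = {} \<Longrightarrow> bu = \<rho>"
    "zeros_after u au \<noteq> {} \<Longrightarrow> bu < \<rho> \<and> zeros_after u bu = zeros_after u au - {bu} \<and> bu \<in> zeros_after u au"
  proof (rule next_zero[OF u])
    show "\<exists>s. au < s \<and> s < t \<and> u s > 0" if "au < t" for t
      using that order slopes starts by (intro sol_pos_right_of_zero[OF u]) auto
  qed (use order ends fin in auto)
  obtain bv where bv: "av < bv" "bv \<le> \<rho>" "v bv = 0" "\<And>t. av < t \<Longrightarrow> t < bv \<Longrightarrow> v t > 0"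
    "zeros_after v av = {} \<Longrightarrow> bv = \<rho>"
    "zeros_after v av \<noteq> {} \<Longrightarrow> bv < \<rho> \<and> zeros_after v bv = zeros_after v av - {bv} \<and> bv \<in> zeros_after v av"
  proof (rule next_zero[OF v])
    show "\<exists>s. av < s \<and> s < t \<and> v s > 0" if "av < t" for t
      using that order slopes starts by (intro sol_pos_right_of_zero[OF v]) auto
  qed (use order ends fin in auto)
  obtain cu where hu: "hump u du au cu bu"
    by (rule hump_exists[OF u, of au bu]) (use order starts bu in auto)
  obtain cv where hv: "hump v dv av cv bv"
    by (rule hump_exists[OF v, of av bv]) (use order starts bv in auto)
  have later: "bv < bu" and steeper: "bu < \<rho> \<Longrightarrow> du bu < dv bv"
    using next_zero_later_and_steeper[OF hu hv order(1,2) starts slopes] by auto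
  show ?case
  proof (rule different_zero_counts_step[OF fin later bu(2) bv(5) bu(6) bv(6)])
    assume "bu < \<rho>" and fin': "finite (zeros_after u bu)" "finite (zeros_after v bv)"
      and less_card: "card (zeros_after u bu) < card (zeros_after u au)"
    have "card (zeros_after (\<lambda>t. - u t) bu) \<noteq> card (zeros_after (\<lambda>t. - v t) bv)"
    proof (rule less.hyps[OF _ sol_uminus[OF u] sol_uminus[OF v]])
      show "0 < - dv bv" "- dv bv < - du bu"
        using hv steeper[OF \<open>bu < \<rho>\<close>] by (auto simp: hump_def)
    qed (use less_card fin' order bv bu later ends \<open>bu < \<rho>\<close> in \<open>simp_all add: zeros_after_uminus\<close>)
    then show "card (zeros_after u bu) \<noteq> card (zeros_after v bv)"
      by (simp add: zeros_after_uminus)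
  qed simp_all
qed

text \<open>Only the first hump has to be treated from the centre; at its end the negated solutions
  meet the conditions of \<open>different_zero_counts\<close>.\<close>

lemma different_zero_counts_from_centre:
  assumes u: "sol u du" and v: "sol v dv" and "0 < v 0" "v 0 < u 0" "du 0 = 0" "dv 0 = 0"
    and ends: "u \<rho> = 0" "v \<rho> = 0" and fin: "finite (zeros_after u 0)" "finite (zeros_after v 0)"
  shows "card (zeros_after u 0) \<noteq> card (zeros_after v 0)"
proof -
  have start: "\<exists>s. 0 < s \<and> s < t \<and> w s > 0" if w: "sol w dw" and "w 0 > 0" and "0 < t" for w dw t
  proof -
    have "continuous_on {0..\<rho>} w" using w by (simp add: sol_def)
    then obtain d where d: "d > 0" "\<And>x. x \<in> {0..\<rho>} \<Longrightarrow> dist x 0 < d \<Longrightarrow> dist (w x) (w 0) < w 0"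
      using \<open>w 0 > 0\<close> rho_pos unfolding continuous_on_iff by (metis atLeastAtMost_iff less_imp_le order.refl)
    obtain s where s: "0 < s" "s < min d (min t \<rho>)"
      using dense[of 0 "min d (min t \<rho>)"] d rho_pos \<open>0 < t\<close> by auto
    then have "w s > 0" using d(2)[of s] by (auto simp: dist_real_def)
    then show ?thesis using s by auto
  qed
  obtain bu where bu: "0 < bu" "bu \<le> \<rho>" "u bu = 0" "\<And>t. 0 < t \<Longrightarrow> t < bu \<Longrightarrow> u t > 0"
    "zeros_after u 0 = {} \<Longrightarrow> bu = \<rho>"
    "zeros_after u 0 \<noteq> {} \<Longrightarrow> bu < \<rho> \<and> zeros_after u bu = zeros_after u 0 - {bu} \<and> bu \<in> zeros_after u 0"
    by (rule next_zero[OF u, of 0]) (use rho_pos ends fin start[OF u] assms in auto)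
  obtain bv where bv: "0 < bv" "bv \<le> \<rho>" "v bv = 0" "\<And>t. 0 < t \<Longrightarrow> t < bv \<Longrightarrow> v t > 0"
    "zeros_after v 0 = {} \<Longrightarrow> bv = \<rho>"
    "zeros_after v 0 \<noteq> {} \<Longrightarrow> bv < \<rho> \<and> zeros_after v bv = zeros_after v 0 - {bv} \<and> bv \<in> zeros_after v 0"
    by (rule next_zero[OF v, of 0]) (use rho_pos ends fin start[OF v] assms in auto)
  have hu: "hump u du 0 0 bu"
  proof (rule hump_from_centre[OF u])
    show "u t > 0" if "0 \<le> t" "t < bu" for t using that bu(4)[of t] assms by (cases "t = 0") auto
  qed (use bu assms in auto)
  have hv: "hump v dv 0 0 bv"
  proof (rule hump_from_centre[OF v])
    show "v t > 0" if "0 \<le> t" "t < bv" for t using that bv(4)[of t] assms by (cases "t = 0") auto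
  qed (use bv assms in auto)
  have later: "bv < bu" and steeper: "bu < \<rho> \<Longrightarrow> du bu < dv bv"
    using first_zero_later_and_steeper[OF hu hv] assms by auto
  show ?thesis
  proof (rule different_zero_counts_step[OF fin later bu(2) bv(5) bu(6) bv(6)])
    assume "bu < \<rho>" and fin': "finite (zeros_after u bu)" "finite (zeros_after v bv)"
    have "card (zeros_after (\<lambda>t. - u t) bu) \<noteq> card (zeros_after (\<lambda>t. - v t) bv)"
    proof (rule different_zero_counts[OF sol_uminus[OF u] sol_uminus[OF v]])
      show "0 < - dv bv" "- dv bv < - du bu"
        using hv steeper[OF \<open>bu < \<rho>\<close>] by (auto simp: hump_def)
    qed (use fin' bv bu later ends \<open>bu < \<rho>\<close> in \<open>simp_all add: zeros_after_uminus\<close>)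
    then show "card (zeros_after u bu) \<noteq> card (zeros_after v bv)"
      by (simp add: zeros_after_uminus)
  qed simp_all
qed

section \<open>The initial value problem\<close>

text \<open>Near a nonzero height \<open>f\<close> is Lipschitz, and Gronwall's lemma applies to the
  squared distance of values and slopes. The centre \<open>a = 0\<close> is included, because the
  singular damping contributes a nonpositive term to the derivative of that distance.\<close>

lemma local_uniqueness_nonzero:
  assumes u: "sol u du" and v: "sol v dv" and a: "0 \<le> a" "a < \<rho>"
    and eq: "u a = v a" "du a = dv a" and pos: "u a > 0"
  obtains c where "a < c" "c \<le> \<rho>" "\<And>t. a \<le> t \<Longrightarrow> t \<le> c \<Longrightarrow> u t = v t"
proof -
  define m where "m = u a"
  have m: "m > 0" using pos by (simp add: m_def)
  obtain L where L: "L \<ge> 0"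
    "\<And>x y. x \<in> {m / 2..2 * m} \<Longrightarrow> y \<in> {m / 2..2 * m} \<Longrightarrow> \<bar>f x - f y\<bar> \<le> L * \<bar>x - y\<bar>"
    using f_lipschitz[of "m / 2" "2 * m"] m by auto
  obtain c1 where c1: "a < c1" "c1 \<le> \<rho>" "\<And>t. a \<le> t \<Longrightarrow> t \<le> c1 \<Longrightarrow> u t \<in> {m / 2<..<2 * m}"
    using right_neighbourhood[OF sol_cont(1)[OF u a(1) order.refl], of "{m / 2<..<2 * m}"] a m
    by (auto simp: m_def)
  obtain c2 where c2: "a < c2" "c2 \<le> \<rho>" "\<And>t. a \<le> t \<Longrightarrow> t \<le> c2 \<Longrightarrow> v t \<in> {m / 2<..<2 * m}"
    using right_neighbourhood[OF sol_cont(1)[OF v a(1) order.refl], of "{m / 2<..<2 * m}"] a m eq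
    by (auto simp: m_def)
  define c where "c = min c1 c2"
  have c: "a < c" "c \<le> \<rho>" using c1 c2 by (auto simp: c_def)
  define x where "x t = u t - v t" for t
  define y where "y t = du t - dv t" for t
  have zero: "(x t)\<^sup>2 + (y t)\<^sup>2 = 0" if "t \<in> {a..c}" for t
  proof (rule gronwall_zero[where g = "\<lambda>t. (x t)\<^sup>2 + (y t)\<^sup>2" and a = a and b = c])
    show "continuous_on {a..c} (\<lambda>t. (x t)\<^sup>2 + (y t)\<^sup>2)"
      unfolding x_def y_def using a c
      by (intro continuous_intros sol_cont(1)[OF u] sol_cont(1)[OF v] sol_cont(2)[OF u] sol_cont(2)[OF v]) auto
    fix t assume t: "a < t" "t < c"
    then have t0: "0 < t" "t < \<rho>" using a c by auto
    have x': "(x has_real_derivative y t) (at t)"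
      unfolding x_def y_def using t0 by (intro DERIV_diff sol_deriv(1)[OF u] sol_deriv(1)[OF v])
    have "(y has_real_derivative
      (- ((real n - 1) / t * du t) - f (u t)) - (- ((real n - 1) / t * dv t) - f (v t))) (at t)"
      unfolding y_def using t0 by (intro DERIV_diff sol_deriv(2)[OF u] sol_deriv(2)[OF v])
    moreover have "(- ((real n - 1) / t * du t) - f (u t)) - (- ((real n - 1) / t * dv t) - f (v t))
        = - ((real n - 1) / t * y t) - (f (u t) - f (v t))"
      by (simp add: y_def algebra_simps diff_divide_distrib)
    ultimately have y': "(y has_real_derivative - ((real n - 1) / t * y t) - (f (u t) - f (v t))) (at t)"
      by (simp only:)
    show "((\<lambda>t. (x t)\<^sup>2 + (y t)\<^sup>2) has_real_derivative
        2 * (x t * y t) + 2 * (y t * (- ((real n - 1) / t * y t) - (f (u t) - f (v t))))) (at t)"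
      by (auto intro!: derivative_eq_intros x' y')
    have "\<bar>f (u t) - f (v t)\<bar> \<le> L * \<bar>x t\<bar>"
      unfolding x_def using c1(3)[of t] c2(3)[of t] t by (intro L(2)) (auto simp: c_def)
    then have "\<bar>y t\<bar> * \<bar>f (u t) - f (v t)\<bar> \<le> \<bar>y t\<bar> * (L * \<bar>x t\<bar>)"
      by (intro mult_left_mono) auto
    then have 1: "- (y t * (f (u t) - f (v t))) \<le> L * \<bar>x t * y t\<bar>"
      using abs_ge_minus_self[of "y t * (f (u t) - f (v t))"] by (simp add: abs_mult mult_ac)
    have 2: "(real n - 1) / t * (y t)\<^sup>2 \<ge> 0" using n_ge_2 t0 by simp
    have 3: "2 * \<bar>x t * y t\<bar> \<le> (x t)\<^sup>2 + (y t)\<^sup>2"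
      using sum_squares_bound[of "\<bar>x t\<bar>" "\<bar>y t\<bar>"] by (simp add: abs_mult)
    have "2 * (x t * y t) + 2 * (y t * (- ((real n - 1) / t * y t) - (f (u t) - f (v t))))
      = 2 * (x t * y t) - 2 * ((real n - 1) / t * (y t)\<^sup>2) + 2 * - (y t * (f (u t) - f (v t)))"
      by (simp add: algebra_simps power2_eq_square)
    also have "\<dots> \<le> 2 * \<bar>x t * y t\<bar> + 2 * (L * \<bar>x t * y t\<bar>)"
      using 1 2 abs_ge_self[of "x t * y t"] by linarith
    also have "\<dots> = (1 + L) * (2 * \<bar>x t * y t\<bar>)" by (simp add: algebra_simps)
    also have "\<dots> \<le> (1 + L) * ((x t)\<^sup>2 + (y t)\<^sup>2)"
      using 3 L(1) by (intro mult_left_mono) auto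
    finally show "2 * (x t * y t) + 2 * (y t * (- ((real n - 1) / t * y t) - (f (u t) - f (v t))))
      \<le> (1 + L) * ((x t)\<^sup>2 + (y t)\<^sup>2)" .
  qed (use eq that in \<open>auto simp: x_def y_def\<close>)
  have "u t = v t" if "a \<le> t" "t \<le> c" for t
    using zero[of t] that by (simp add: sum_power2_eq_zero_iff x_def)
  then show thesis using that c by blast
qed

text \<open>Gronwall's lemma is applied to the distance of the two curves \<open>(radius, slope)\<close> at equal heights,
  with \<open>\<psi> t\<close> the radius at which \<open>v\<close> has the height \<open>u t\<close>.\<close>
lemma local_uniqueness_simple_zero:
  assumes u: "sol u du" and v: "sol v dv" and a: "0 < a" "a < \<rho>"
    and eq: "u a = 0" "v a = 0" "du a = dv a" and slope: "du a > 0"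
  obtains c where "a < c" "c \<le> \<rho>" "\<And>t. a \<le> t \<Longrightarrow> t \<le> c \<Longrightarrow> u t = v t"
proof -
  obtain b1 where b1: "a < b1" "b1 \<le> \<rho>" "\<And>t. a \<le> t \<Longrightarrow> t \<le> b1 \<Longrightarrow> du t \<in> {0<..}"
    using right_neighbourhood[OF sol_cont(2)[OF u _ order.refl], of a "{0<..}"] a slope by auto
  obtain b2 where b2: "a < b2" "b2 \<le> \<rho>" "\<And>t. a \<le> t \<Longrightarrow> t \<le> b2 \<Longrightarrow> dv t \<in> {0<..}"
    using right_neighbourhood[OF sol_cont(2)[OF v _ order.refl], of a "{0<..}"] a slope eq by auto
  obtain R where R_cont: "continuous_on {v a..v b2} R"
    and R_left: "\<And>t. t \<in> {a..b2} \<Longrightarrow> R (v t) = t"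
    and R: "\<And>s. s \<in> {v a..v b2} \<Longrightarrow> R s \<in> {a..b2} \<and> v (R s) = s"
    and R_deriv: "\<And>s. v a < s \<Longrightarrow> s < v b2 \<Longrightarrow>
       a < R s \<and> R s < b2 \<and> (R has_real_derivative 1 / dv (R s)) (at s)"
  proof (rule inverse_of_increasing[of a b2 v dv])
    show "continuous_on {a..b2} v" using a b2 by (intro sol_cont(1)[OF v]) auto
    show "(v has_real_derivative dv t) (at t)" if "a < t" "t < b2" for t
      using that a b2 by (intro sol_deriv(1)[OF v]) auto
    show "dv t > 0" if "a < t" "t < b2" for t
      using b2(3)[of t] that by simp
  qed (use b2 in blast)+
  have incr: "w x < w y"
    if w: "sol w dw" and "a \<le> x" "x < y" "y \<le> \<rho>" and p: "\<And>t. a \<le> t \<Longrightarrow> t \<le> y \<Longrightarrow> dw t \<in> {0<..}" for w dw x y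
  proof (rule DERIV_pos_imp_increasing_open[where f = w, OF \<open>x < y\<close>])
    fix t assume t: "x < t" "t < y"
    then show "\<exists>d. (w has_real_derivative d) (at t) \<and> d > 0"
      using that a p[of t] sol_deriv(1)[OF w, of t] by (intro exI[of _ "dw t"]) auto
  qed (use that a in \<open>auto intro: sol_cont(1)[OF w]\<close>)
  have "v b2 > 0" using incr[OF v, of a b2] b2 eq by auto
  obtain c1 where c1: "a < c1" "c1 \<le> \<rho>" "\<And>t. a \<le> t \<Longrightarrow> t \<le> c1 \<Longrightarrow> u t \<in> {..<v b2}"
    using right_neighbourhood[OF sol_cont(1)[OF u _ order.refl], of a "{..<v b2}"] a \<open>v b2 > 0\<close> eq by auto
  define c where "c = min b1 c1"
  have c: "a < c" "c \<le> \<rho>" using c1 b1 by (auto simp: c_def)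
  have u_range: "0 \<le> u t" "u t < v b2" and du_pos: "du t > 0" if "a \<le> t" "t \<le> c" for t
    using c1(3)[of t] b1(3)[of t] incr[OF u, of a t] that b1(2,3) c eq by (cases "t = a"; force simp: c_def)+
  have u_pos: "0 < u t" if "a < t" "t \<le> c" for t
    using incr[OF u, of a t] that b1(2,3) eq by (force simp: c_def)
  define \<psi> where "\<psi> t = R (u t)" for t
  have \<psi>: "a \<le> \<psi> t" "\<psi> t \<le> b2" "v (\<psi> t) = u t" if "a \<le> t" "t \<le> c" for t
    using R[of "u t"] u_range[OF that] eq by (auto simp: \<psi>_def)
  define x where "x t = t - \<psi> t" for t
  define y where "y t = du t - dv (\<psi> t)" for t
  have \<psi>_cont: "continuous_on {a..c} \<psi>"
    unfolding \<psi>_def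
  proof (rule continuous_on_compose2[OF R_cont])
    show "continuous_on {a..c} u" using a c by (intro sol_cont(1)[OF u]) auto
    show "u ` {a..c} \<subseteq> {v a..v b2}" using u_range eq by (auto simp: less_imp_le)
  qed
  have dv\<psi>_cont: "continuous_on {a..c} (\<lambda>t. dv (\<psi> t))"
    using \<psi> \<psi>_cont a b2 by (intro continuous_on_compose2[OF sol_cont(2)[OF v, of a b2]]) auto
  have dv\<psi>_pos: "dv (\<psi> t) > 0" if "a \<le> t" "t \<le> c" for t
    using b2(3)[of "\<psi> t"] \<psi>[OF that] by simp
  \<comment> \<open>These are the coefficients for which the derivative of the squared distance is
    \<open>A t * (x t * y t) + B t * (y t)^2\<close>. At equal heights \<open>f\<close> enters
    through the common value \<open>f (u t)\<close>, so continuity on a compact interval replaces a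
    Lipschitz bound.\<close>
  define A where "A t = 2 * (real n - 1) * du t / (\<psi> t * t) - 2 / dv (\<psi> t)" for t
  define B where "B t = 2 * f (u t) / dv (\<psi> t)" for t
  have nz: "\<psi> t \<noteq> 0" "dv (\<psi> t) \<noteq> 0" "t \<noteq> 0" if "t \<in> {a..c}" for t
    using \<psi>[of t] dv\<psi>_pos[of t] a that by auto
  have "continuous_on {a..c} A"
    unfolding A_def using a c nz
    by (intro continuous_intros \<psi>_cont dv\<psi>_cont sol_cont(2)[OF u]) auto
  then have "compact (A ` {a..c})" by (rule compact_continuous_image) simp
  then obtain A0 where A0: "\<And>t. t \<in> {a..c} \<Longrightarrow> \<bar>A t\<bar> \<le> A0"
    by (metis bounded_iff compact_imp_bounded image_eqI real_norm_def)
  have "continuous_on {a..c} B"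
    unfolding B_def using a c nz
    by (intro continuous_intros dv\<psi>_cont continuous_on_compose2[OF f_cont] sol_cont(1)[OF u]) auto
  then have "compact (B ` {a..c})" by (rule compact_continuous_image) simp
  then obtain B0 where B0: "\<And>t. t \<in> {a..c} \<Longrightarrow> \<bar>B t\<bar> \<le> B0"
    by (metis bounded_iff compact_imp_bounded image_eqI real_norm_def)
  have zero: "(x t)\<^sup>2 + (y t)\<^sup>2 = 0" if "t \<in> {a..c}" for t
  proof (rule gronwall_zero[where g = "\<lambda>t. (x t)\<^sup>2 + (y t)\<^sup>2" and a = a and b = c])
    show "continuous_on {a..c} (\<lambda>t. (x t)\<^sup>2 + (y t)\<^sup>2)"
      unfolding x_def y_def using a c
      by (intro continuous_intros \<psi>_cont dv\<psi>_cont sol_cont(2)[OF u]) auto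
    show "(x a)\<^sup>2 + (y a)\<^sup>2 = 0"
      using R_left[of a] eq b2 by (simp add: x_def y_def \<psi>_def)
    fix t assume t: "a < t" "t < c"
    then have t0: "0 < t" "t < \<rho>" "t \<in> {a..c}" using a c by auto
    have \<psi>t: "0 < \<psi> t" "\<psi> t < \<rho>" and R': "(R has_real_derivative 1 / dv (\<psi> t)) (at (u t))"
      using R_deriv[of "u t"] u_pos[of t] u_range[of t] t a b2 eq by (auto simp: \<psi>_def)
    have p: "dv (\<psi> t) > 0" and v\<psi>: "v (\<psi> t) = u t" using dv\<psi>_pos[of t] \<psi>[of t] t by auto
    have \<psi>': "(\<psi> has_real_derivative 1 / dv (\<psi> t) * du t) (at t)"
      unfolding \<psi>_def using R' t0 by (intro DERIV_chain2[where f = R] sol_deriv(1)[OF u]) (auto simp: \<psi>_def)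
    have "(x has_real_derivative 1 - 1 / dv (\<psi> t) * du t) (at t)"
      unfolding x_def by (intro DERIV_diff DERIV_ident \<psi>')
    moreover have "1 - 1 / dv (\<psi> t) * du t = - y t / dv (\<psi> t)"
      using p by (simp add: y_def field_simps)
    ultimately have x': "(x has_real_derivative - y t / dv (\<psi> t)) (at t)" by simp
    have "(y has_real_derivative
        (- ((real n - 1) / t * du t) - f (u t))
          - (- ((real n - 1) / \<psi> t * dv (\<psi> t)) - f (v (\<psi> t))) * (1 / dv (\<psi> t) * du t)) (at t)"
      unfolding y_def using t0 \<psi>t
      by (intro DERIV_diff DERIV_chain2[where f = dv] sol_deriv(2)[OF u] sol_deriv(2)[OF v] \<psi>') auto
    moreover have "(- ((real n - 1) / t * du t) - f (u t))
          - (- ((real n - 1) / \<psi> t * dv (\<psi> t)) - f (v (\<psi> t))) * (1 / dv (\<psi> t) * du t)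
        = (real n - 1) * du t / (\<psi> t * t) * x t + f (u t) / dv (\<psi> t) * y t"
      using p t0 \<psi>t v\<psi> by (simp add: x_def y_def field_simps)
    ultimately have y': "(y has_real_derivative
        (real n - 1) * du t / (\<psi> t * t) * x t + f (u t) / dv (\<psi> t) * y t) (at t)" by simp
    have "((\<lambda>t. (x t)\<^sup>2 + (y t)\<^sup>2) has_real_derivative
        2 * (x t * (- y t / dv (\<psi> t)))
        + 2 * (y t * ((real n - 1) * du t / (\<psi> t * t) * x t + f (u t) / dv (\<psi> t) * y t))) (at t)"
      by (auto intro!: derivative_eq_intros x' y')
    moreover have "2 * (x t * (- y t / dv (\<psi> t)))
        + 2 * (y t * ((real n - 1) * du t / (\<psi> t * t) * x t + f (u t) / dv (\<psi> t) * y t))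
        = A t * (x t * y t) + B t * (y t)\<^sup>2"
      by (simp add: A_def B_def algebra_simps power2_eq_square)
    ultimately show "((\<lambda>t. (x t)\<^sup>2 + (y t)\<^sup>2) has_real_derivative A t * (x t * y t) + B t * (y t)\<^sup>2) (at t)"
      by simp
    have "2 * \<bar>x t * y t\<bar> \<le> (x t)\<^sup>2 + (y t)\<^sup>2"
      using sum_squares_bound[of "\<bar>x t\<bar>" "\<bar>y t\<bar>"] by (simp add: abs_mult)
    then have xy: "\<bar>x t * y t\<bar> \<le> (x t)\<^sup>2 + (y t)\<^sup>2" by linarith
    have "A t * (x t * y t) \<le> \<bar>A t\<bar> * \<bar>x t * y t\<bar>"
      by (metis abs_ge_self abs_mult)
    also have "\<dots> \<le> A0 * ((x t)\<^sup>2 + (y t)\<^sup>2)"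
      using A0[OF t0(3)] xy by (intro mult_mono) auto
    finally have "A t * (x t * y t) \<le> A0 * ((x t)\<^sup>2 + (y t)\<^sup>2)" .
    moreover have "B t * (y t)\<^sup>2 \<le> B0 * ((x t)\<^sup>2 + (y t)\<^sup>2)"
      using B0[OF t0(3)] by (intro mult_mono) auto
    ultimately show "A t * (x t * y t) + B t * (y t)\<^sup>2 \<le> (A0 + B0) * ((x t)\<^sup>2 + (y t)\<^sup>2)"
      by (simp add: distrib_right)
  qed (use that in auto)
  \<comment> \<open>\<open>x t = 0\<close> says that \<open>\<psi> t = t\<close>: the common height
    is attained at the same radius.\<close>
  have "u t = v t" if "a \<le> t" "t \<le> c" for t
    using zero[of t] \<psi>(3)[of t] that by (simp add: sum_power2_eq_zero_iff x_def)
  then show thesis using that c by blast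
qed

lemma local_uniqueness:
  assumes u: "sol u du" and v: "sol v dv" and a: "0 \<le> a" "a < \<rho>"
    and eq: "u a = v a" "du a = dv a" and nondeg: "u a \<noteq> 0 \<or> 0 < a \<and> du a \<noteq> 0"
  obtains c where "a < c" "c \<le> \<rho>" "\<And>t. a \<le> t \<Longrightarrow> t \<le> c \<Longrightarrow> u t = v t"
proof -
  note u' = sol_uminus[OF u] and v' = sol_uminus[OF v]
  consider "u a > 0" | "u a < 0" | "u a = 0" "0 < a" "du a > 0" | "u a = 0" "0 < a" "du a < 0"
    using nondeg by linarith
  then show thesis
  proof cases
    case 1
    then show thesis using local_uniqueness_nonzero[OF u v a eq] that by metis
  next
    case 2
    then show thesis using local_uniqueness_nonzero[OF u' v' a] eq that
      by (metis neg_0_less_iff_less neg_equal_iff_equal)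
  next
    case 3
    then show thesis using local_uniqueness_simple_zero[OF u v _ a(2)] eq that by metis
  next
    case 4
    then show thesis using local_uniqueness_simple_zero[OF u' v' _ a(2)] eq that
      by (metis neg_0_less_iff_less neg_equal_iff_equal neg_0_equal_iff_equal)
  qed
qed

text \<open>On an interval to the left of \<open>a\<close> the solution has one sign, say positive,
  and its flux strictly decreases. With \<open>du a \<ge> 0\<close> the flux would be positive
  before \<open>a\<close>, and \<open>u\<close> would increase from positive values to 0.\<close>

lemma simple_zero:
  assumes u: "sol u du" and a: "0 < a" "a < \<rho>" "u a = 0" and fin: "finite (zeros_after u 0)"
  shows "du a \<noteq> 0"
proof -
  have neg: "dw a < 0"
    if w: "sol w dw" and "w a = 0" and l: "0 \<le> l" "l < a" and pos: "\<And>t. l < t \<Longrightarrow> t < a \<Longrightarrow> w t > 0" for w dw l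
  proof (rule ccontr)
    assume "\<not> dw a < 0"
    obtain m where m: "l < m" "m < a" using dense[OF \<open>l < a\<close>] by blast
    have "w m < w a"
    proof (rule DERIV_pos_imp_increasing_open[where f = w, OF m(2)])
      fix t assume t: "m < t" "t < a"
      have "a ^ (n - 1) * dw a < t ^ (n - 1) * dw t"
        using flux_strict_antimono[OF w \<open>0 \<le> l\<close> _ pos, of a t a] t m a by auto
      moreover have "a ^ (n - 1) * dw a \<ge> 0" using a \<open>\<not> dw a < 0\<close> by simp
      ultimately have "dw t > 0" using t m l by (auto simp: zero_less_mult_iff dest: order.strict_trans1)
      then show "\<exists>d. (w has_real_derivative d) (at t) \<and> d > 0"
        using sol_deriv(1)[OF w, of t] t m l a by auto
    qed (use m l a in \<open>auto intro: sol_cont(1)[OF w]\<close>)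
    then show False using pos[of m] m \<open>w a = 0\<close> by simp
  qed
  \<comment> \<open>The last zero before \<open>a\<close>, or the centre if there is none; the
    maximum exists because the zeros are finite in number.\<close>
  define l where "l = Max (insert 0 (zeros_after u 0 \<inter> {..<a}))"
  have "l \<in> insert 0 (zeros_after u 0 \<inter> {..<a})"
    unfolding l_def by (rule Max_in) (use fin in auto)
  then have l: "0 \<le> l" "l < a" using a by (auto simp: zeros_after_def)
  have nz: "u t \<noteq> 0" if "l < t" "t < a" for t
  proof
    assume "u t = 0"
    then have "t \<in> insert 0 (zeros_after u 0 \<inter> {..<a})"
      using that l a by (auto simp: zeros_after_def)
    then have "t \<le> l" unfolding l_def by (intro Max_ge) (use fin in auto)
    then show False using that by simp
  qed
  obtain m where m: "l < m" "m < a" using dense[OF \<open>l < a\<close>] by blast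
  have cont: "continuous_on {l<..<a} u"
    using sol_cont(1)[OF u, of l a] l a by (auto intro: continuous_on_subset)
  show ?thesis
  proof (cases "u m > 0")
    case True
    then have "\<And>t. l < t \<Longrightarrow> t < a \<Longrightarrow> u t > 0"
      using constant_sign_if_no_zeros[OF cont nz, of m] m by blast
    then show ?thesis using neg[OF u a(3) l] by simp
  next
    case False
    then have "- u m > 0" using nz[OF m] by linarith
    then have "\<And>t. l < t \<Longrightarrow> t < a \<Longrightarrow> - u t > 0"
      using constant_sign_if_no_zeros[OF continuous_on_minus[OF cont], of m] nz m by simp
    then show ?thesis using neg[OF sol_uminus[OF u] _ l] a(3) by simp
  qed
qed

text \<open>At the infimum \<open>T\<close> of the radii of disagreement, values and slopes agree by
  continuity. Since \<open>u 0\<close> is nonzero and interior zeros are simple, local uniqueness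
  applies at \<open>T\<close> and extends the agreement beyond it.\<close>

lemma uniqueness_from_centre:
  assumes u: "sol u du" and v: "sol v dv" and start: "u 0 = v 0" "u 0 \<noteq> 0" "du 0 = 0" "dv 0 = 0"
    and ends: "u \<rho> = v \<rho>" and fin: "finite (zeros_after u 0)" and t: "t \<in> {0..\<rho>}"
  shows "u t = v t"
proof (rule ccontr)
  assume "u t \<noteq> v t"
  define S where "S = {s \<in> {0..\<rho>}. u s \<noteq> v s}"
  have tS: "t \<in> S" using \<open>u t \<noteq> v t\<close> t by (simp add: S_def)
  have bdd: "bdd_below S" by (auto simp: S_def bdd_below_def)
  define T where "T = Inf S"
  have "T \<le> t" unfolding T_def using tS bdd by (rule cInf_lower)
  moreover have "0 \<le> T"
    unfolding T_def by (rule cInf_greatest) (use tS in \<open>auto simp: S_def\<close>)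
  ultimately have T: "0 \<le> T" "T \<le> t" by simp_all
  have before: "u s = v s" if "0 \<le> s" "s < T" for s
  proof (rule ccontr)
    assume "u s \<noteq> v s"
    then have "s \<in> S" using that T t by (simp add: S_def)
    then have "T \<le> s" unfolding T_def using bdd by (rule cInf_lower)
    then show False using that by simp
  qed
  have before_deriv: "du s = dv s" if s: "0 < s" "s < T" for s
  proof -
    have "((\<lambda>r. u r - v r) has_real_derivative du s - dv s) (at s)"
      using s T t by (intro DERIV_diff sol_deriv(1)[OF u] sol_deriv(1)[OF v]) auto
    moreover have "\<forall>r. \<bar>s - r\<bar> < min s (T - s) \<longrightarrow> u s - v s = u r - v r"
    proof (intro allI impI)
      fix r assume "\<bar>s - r\<bar> < min s (T - s)"
      then have "0 \<le> r" "r < T" by linarith+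
      then show "u s - v s = u r - v r" using before s by simp
    qed
    ultimately have "du s - dv s = 0"
      using s by (intro DERIV_local_const[where d = "min s (T - s)"]) auto
    then show ?thesis by simp
  qed
  have eqT: "u T = v T" "du T = dv T"
  proof -
    have "u T - v T = 0" if "T \<noteq> 0"
    proof (rule eq_at_right_endpoint[where g = "\<lambda>s. u s - v s"])
      show "continuous_on {0..T} (\<lambda>s. u s - v s)"
        using T t by (intro continuous_on_diff sol_cont(1)[OF u] sol_cont(1)[OF v]) auto
    qed (use that T before in auto)
    moreover have "du T - dv T = 0" if "T \<noteq> 0"
    proof (rule eq_at_right_endpoint[where g = "\<lambda>s. du s - dv s"])
      show "continuous_on {0..T} (\<lambda>s. du s - dv s)"
        using T t by (intro continuous_on_diff sol_cont(2)[OF u] sol_cont(2)[OF v]) auto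
    qed (use that T before_deriv in auto)
    ultimately show "u T = v T" "du T = dv T" using start by (cases "T = 0"; simp)+
  qed
  \<comment> \<open>Otherwise \<open>t\<close> would be \<open>\<rho>\<close> itself, where the two
    end values coincide.\<close>
  have "T \<noteq> \<rho>" using T t \<open>u t \<noteq> v t\<close> ends by force
  then have "T < \<rho>" using T t by simp
  moreover have "u T \<noteq> 0 \<or> 0 < T \<and> du T \<noteq> 0"
    using simple_zero[OF u, of T] T \<open>T < \<rho>\<close> start fin by force
  ultimately obtain c where c: "T < c" "c \<le> \<rho>" "\<And>s. T \<le> s \<Longrightarrow> s \<le> c \<Longrightarrow> u s = v s"
    using local_uniqueness[OF u v T(1) _ eqT] by blast
  have "c \<le> Inf S"
  proof (rule cInf_greatest)
    show "S \<noteq> {}" using tS by auto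
    show "c \<le> s" if "s \<in> S" for s
      using that before[of s] c(3)[of s] by (force simp: S_def)
  qed
  then show False using c by (simp add: T_def)
qed

end

section \<open>Nodal solutions\<close>

lemma C2_on_Icc_deriv:
  assumes "C2_on {0..\<rho>} u"
  defines "du \<equiv> deriv_within {0..\<rho>} u"
  shows "continuous_on {0..\<rho>} u" "continuous_on {0..\<rho>} du"
    and "\<And>t. 0 < t \<Longrightarrow> t < \<rho> \<Longrightarrow> (u has_real_derivative du t) (at t)"
    and "\<And>t. 0 < t \<Longrightarrow> t < \<rho> \<Longrightarrow> (du has_real_derivative deriv_within {0..\<rho>} du t) (at t)"
proof -
  have d: "u differentiable_on {0..\<rho>}" "du differentiable_on {0..\<rho>}"
    using assms by (auto simp: C2_on_def)
  then show "continuous_on {0..\<rho>} u" "continuous_on {0..\<rho>} du"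
    by (auto intro: differentiable_imp_continuous_on)
  have "(w has_real_derivative deriv_within {0..\<rho>} w t) (at t)"
    if w: "w differentiable_on {0..\<rho>}" and t: "0 < t" "t < \<rho>" for w t
  proof -
    have "w differentiable (at t within {0..\<rho>})" using w t by (simp add: differentiable_on_def)
    then show ?thesis
      unfolding deriv_within_def has_real_derivative_iff_has_vector_derivative at_within_Icc_at[OF t]
      by (simp add: vector_derivative_works)
  qed
  then show "\<And>t. 0 < t \<Longrightarrow> t < \<rho> \<Longrightarrow> (u has_real_derivative du t) (at t)"
    and "\<And>t. 0 < t \<Longrightarrow> t < \<rho> \<Longrightarrow> (du has_real_derivative deriv_within {0..\<rho>} du t) (at t)"
    using d by (auto simp: du_def)
qed

lemma (in sublinear_radial) radial_solution_sol:
  assumes "radial_solution n \<rho> f u"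
  shows "sol u (deriv_within {0..\<rho>} u)"
proof -
  define du where "du = deriv_within {0..\<rho>} u"
  have C2: "C2_on {0..\<rho>} u" and ode: "\<And>t. 0 < t \<Longrightarrow> t < \<rho> \<Longrightarrow>
      deriv_within {0..\<rho>} du t + (real n - 1) / t * du t + f (u t) = 0"
    using assms by (auto simp: radial_solution_def du_def)
  note d = C2_on_Icc_deriv[OF C2, folded du_def]
  have "deriv_within {0..\<rho>} du t = - ((real n - 1) / t * du t) - f (u t)" if "0 < t" "t < \<rho>" for t
    using ode[OF that] by linarith
  then show ?thesis
    unfolding sol_def du_def[symmetric] using d by metis
qed

theorem theorem1p3:
  fixes n k :: nat and \<rho> :: real and f :: "real \<Rightarrow> real"
  assumes "n \<ge> 2"
    and "\<rho> > 0"
    and "continuous_on UNIV f"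
    and "\<And>s. f (- s) = - f s"
    and "f 0 = 0"
    and "\<And>s. s > 0 \<Longrightarrow> s * f s > 0"
    and "f differentiable_on {0<..}"
    and "continuous_on {0<..} (deriv f)"
    and "deriv f absolutely_integrable_on {0<..<1}"
    and "\<And>s. s > 0 \<Longrightarrow> f s \<ge> s * deriv f s"
    and "\<And>\<epsilon>. \<epsilon> > 0 \<Longrightarrow> \<exists>s\<in>{0<..<\<epsilon>}. f s > s * deriv f s"
  shows "\<forall>u v. radial_solution n \<rho> f u \<and> u 0 > 0 \<and> has_exactly_zeros k {0<..<\<rho>} u \<and>
               radial_solution n \<rho> f v \<and> v 0 > 0 \<and> has_exactly_zeros k {0<..<\<rho>} v
           \<longrightarrow> (\<forall>r\<in>{0..\<rho>}. u r = v r)"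
proof (intro allI impI ballI, elim conjE)
  interpret sublinear_radial n \<rho> f
  proof
    show "f s > 0" if "s > 0" for s using assms(6)[OF that] that by (simp add: zero_less_mult_iff)
  qed (fact assms)+
  fix u v r
  assume ru: "radial_solution n \<rho> f u" and rv: "radial_solution n \<rho> f v" and pos: "u 0 > 0" "v 0 > 0"
    and zu: "has_exactly_zeros k {0<..<\<rho>} u" and zv: "has_exactly_zeros k {0<..<\<rho>} v"
    and r: "r \<in> {0..\<rho>}"
  note su = radial_solution_sol[OF ru] and sv = radial_solution_sol[OF rv]
  have bc: "deriv_within {0..\<rho>} u 0 = 0" "deriv_within {0..\<rho>} v 0 = 0" "u \<rho> = 0" "v \<rho> = 0"
    using ru rv by (auto simp: radial_solution_def)
  have counts: "finite (zeros_after u 0)" "card (zeros_after u 0) = k"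
    "finite (zeros_after v 0)" "card (zeros_after v 0) = k"
    using zu zv by (auto simp: has_exactly_zeros_def zeros_after_def)
  \<comment> \<open>Either strict order of the initial values would lead to different numbers of
    zeros.\<close>
  have "u 0 = v 0"
    using different_zero_counts_from_centre[OF su sv] different_zero_counts_from_centre[OF sv su]
      bc counts pos by (cases "u 0" "v 0" rule: linorder_cases) auto
  then show "u r = v r"
    using uniqueness_from_centre[OF su sv] bc counts pos r by auto
qed

end
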